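(* Let $G$ be an (infinite) 1-ended Cayley graph with a finite presentation $\mathcal{P}$. Then $p_{\mathbb{C}}\le 1-1/\dot{\gamma}_{\mathcal{P}}$ for site percolation on $G$, where $\dot{\gamma}_{\mathcal{P}}=\big(d^{\,m_{\mathcal{P}}}-1\big)e$, $d$ is the degree of $G$, $m_{\mathcal{P}}=\lfloor t/2\rfloor$, $t$ is the length of the longest cycle of $G$ induced by a relator of $\mathcal{P}$, and $e$ is Euler's number.
   Context: $G$ is the Cayley graph of the group defined by the finite presentation $\mathcal{P}=\langle\mathcal{S}\mid\mathcal{R}\rangle$ with respect to the generating set $\mathcal{S}$. The closed walks of $G$ induced by the relators in $\mathcal{R}$ (starting at any vertex) are assumed to be cycles of $G$. In Bernoulli site percolation with parameter $p$ each vertex is independently occupied with probability $p$ and vacant otherwise; $\Pr_p$ is the law. For a fixed vertex $o$, $C(o)$ is the connected component of $o$ in the subgraph induced by the occupied vertices (empty if $o$ is vacant), $\theta_o(p):=\Pr_p(|C(o)|=\infty)$, and $p_{\mathbb{C}}:=\inf\{p\le 1 : \theta_o \text{ is analytic in } (p,1]\}$. A function $f$ is analytic on an interval $I\subset\mathbb{R}$ if every $x\in I$ is the centre of an open disc $D\subset\mathbb{C}$ on which there is a holomorphic function agreeing with $f$ on $D\cap I$. *)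

theory Defs
  imports
    "HOL-Analysis.Analysis"
    "HOL-Probability.Probability"
    "HOL-Algebra.Group"
    "Graph_Theory.Graph_Theory"
begin

section \<open>The group defined by a presentation\<close>

text \<open>The letter \<open>(s, True)\<close> stands for the generator \<open>s\<close> and \<open>(s, False)\<close> for its formal inverse.\<close>

type_synonym 'a word = "('a \<times> bool) list"

definition words :: "'a set \<Rightarrow> 'a word set" where
  "words S = lists (S \<times> UNIV)"

inductive_set word_cong :: "'a set \<Rightarrow> 'a word set \<Rightarrow> 'a word rel"
  for S :: "'a set" and R :: "'a word set"
where
  refl: "w \<in> words S \<Longrightarrow> (w, w) \<in> word_cong S R"
| sym: "(u, v) \<in> word_cong S R \<Longrightarrow> (v, u) \<in> word_cong S R"
| trans: "(u, v) \<in> word_cong S R \<Longrightarrow> (v, w) \<in> word_cong S R \<Longrightarrow> (u, w) \<in> word_cong S R"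
| cancel: "u \<in> words S \<Longrightarrow> v \<in> words S \<Longrightarrow> s \<in> S \<Longrightarrow>
    (u @ [(s, b), (s, \<not> b)] @ v, u @ v) \<in> word_cong S R"
| relator: "u \<in> words S \<Longrightarrow> v \<in> words S \<Longrightarrow> r \<in> R \<Longrightarrow> r \<in> words S \<Longrightarrow>
    (u @ r @ v, u @ v) \<in> word_cong S R"

definition word_class :: "'a set \<Rightarrow> 'a word set \<Rightarrow> 'a word \<Rightarrow> 'a word set" where
  "word_class S R w = word_cong S R `` {w}"

definition presented_group :: "'a set \<Rightarrow> 'a word set \<Rightarrow> 'a word set monoid" where
  "presented_group S R =
    \<lparr>carrier = words S // word_cong S R,
     mult = (\<lambda>A B. \<Union>u\<in>A. \<Union>v\<in>B. word_class S R (u @ v)),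
     one = word_class S R []\<rparr>"

definition generators :: "'a set \<Rightarrow> 'a word set \<Rightarrow> 'a word set set" where
  "generators S R = (\<lambda>s. word_class S R [(s, True)]) ` S"

lemma words_append [simp]: "u @ v \<in> words S \<longleftrightarrow> u \<in> words S \<and> v \<in> words S"
  by (auto simp: words_def)

lemma words_Nil [simp]: "[] \<in> words S"
  by (simp add: words_def)

lemma word_cong_in_words:
  "(u, v) \<in> word_cong S R \<Longrightarrow> u \<in> words S \<and> v \<in> words S"
  by (induction rule: word_cong.induct) (auto simp: words_def)

lemma word_cong_equiv: "equiv (words S) (word_cong S R)"
proof (rule equivI)
  show "word_cong S R \<subseteq> words S \<times> words S"
    using word_cong_in_words by fastforce
  show "refl_on (words S) (word_cong S R)"
    by (auto simp: refl_on_def dest: word_cong_in_words intro: word_cong.refl)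
  show "Relation.sym (word_cong S R)"
    by (auto simp: sym_def intro: word_cong.sym)
  show "Relation.trans (word_cong S R)"
    by (auto simp: trans_def intro: word_cong.trans)
qed

lemma word_cong_append_left:
  "(u, v) \<in> word_cong S R \<Longrightarrow> w \<in> words S \<Longrightarrow> (w @ u, w @ v) \<in> word_cong S R"
proof (induction rule: word_cong.induct)
  case (cancel u v s b)
  then show ?case using word_cong.cancel[of "w @ u" S v s b R] by simp
next
  case (relator u v r)
  then show ?case using word_cong.relator[of "w @ u" S v r R] by simp
qed (auto intro: word_cong.refl word_cong.sym word_cong.trans)

lemma word_cong_append_right:
  "(u, v) \<in> word_cong S R \<Longrightarrow> w \<in> words S \<Longrightarrow> (u @ w, v @ w) \<in> word_cong S R"
proof (induction rule: word_cong.induct)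
  case (cancel u v s b)
  then show ?case using word_cong.cancel[of u S "v @ w" s b R] by simp
next
  case (relator u v r)
  then show ?case using word_cong.relator[of u S "v @ w" r R] by simp
qed (auto intro: word_cong.refl word_cong.sym word_cong.trans)

lemma word_class_eq_iff:
  assumes "u \<in> words S" "v \<in> words S"
  shows "word_class S R u = word_class S R v \<longleftrightarrow> (u, v) \<in> word_cong S R"
  unfolding word_class_def using eq_equiv_class_iff[OF word_cong_equiv assms] .

lemma carrier_presented_group:
  "carrier (presented_group S R) = word_class S R ` words S"
  by (auto simp: presented_group_def quotient_def word_class_def)

lemma mult_presented_group:
  assumes "u \<in> words S" "v \<in> words S"
  shows "word_class S R u \<otimes>\<^bsub>presented_group S R\<^esub> word_class S R v = word_class S R (u @ v)"
proof -
  have "word_class S R (u' @ v') = word_class S R (u @ v)"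
    if "u' \<in> word_class S R u" "v' \<in> word_class S R v" for u' v'
  proof -
    have c: "(u, u') \<in> word_cong S R" "(v, v') \<in> word_cong S R"
      using that by (auto simp: word_class_def)
    then have w: "u' \<in> words S" "v' \<in> words S"
      using word_cong_in_words by blast+
    have "(u @ v, u' @ v') \<in> word_cong S R"
      using word_cong.trans[OF word_cong_append_right[OF c(1) assms(2)]
        word_cong_append_left[OF c(2) w(1)]] .
    then show ?thesis
      using assms w by (simp add: word_class_eq_iff word_cong.sym)
  qed
  note eq = this
  have mem: "u \<in> word_class S R u" "v \<in> word_class S R v"
    using assms by (auto simp: word_class_def intro: word_cong.refl)
  have "(\<Union>u'\<in>word_class S R u. \<Union>v'\<in>word_class S R v. word_class S R (u' @ v')) =
      (\<Union>u'\<in>word_class S R u. \<Union>v'\<in>word_class S R v. word_class S R (u @ v))"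
    using eq by (intro SUP_cong) auto
  also have "\<dots> = word_class S R (u @ v)"
    using mem by blast
  finally show ?thesis
    by (simp add: presented_group_def)
qed

lemma word_inverse:
  "w \<in> words S \<Longrightarrow> \<exists>w'\<in>words S. (w' @ w, []) \<in> word_cong S R"
proof (induction w)
  case Nil
  then show ?case by (auto intro!: bexI[of _ "[]"] word_cong.refl)
next
  case (Cons x w)
  obtain s b where x: "x = (s, b)" by force
  have s: "s \<in> S" and w: "w \<in> words S"
    using Cons.prems by (auto simp: words_def x)
  obtain w' where w': "w' \<in> words S" "(w' @ w, []) \<in> word_cong S R"
    using Cons.IH[OF w] by blast
  have "(w' @ [(s, \<not> b), (s, b)] @ w, w' @ w) \<in> word_cong S R"
    using word_cong.cancel[OF w'(1) w s, of "\<not> b" R] by simp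
  then have "((w' @ [(s, \<not> b)]) @ x # w, []) \<in> word_cong S R"
    using word_cong.trans[OF _ w'(2)] by (simp add: x)
  moreover have "w' @ [(s, \<not> b)] \<in> words S"
    using w'(1) s by (simp add: words_def)
  ultimately show ?case by blast
qed

lemma group_presented_group: "group (presented_group S R)" (is "group ?P")
proof (rule groupI)
  have one: "\<one>\<^bsub>?P\<^esub> = word_class S R []"
    by (simp add: presented_group_def)
  have rep: "\<exists>w\<in>words S. x = word_class S R w" if "x \<in> carrier ?P" for x
    using that unfolding carrier_presented_group by blast
  have cls: "word_class S R w \<in> carrier ?P" if "w \<in> words S" for w
    using that unfolding carrier_presented_group by blast
  show "\<one>\<^bsub>?P\<^esub> \<in> carrier ?P"
    unfolding one by (rule cls) simp
  show "x \<otimes>\<^bsub>?P\<^esub> y \<in> carrier ?P" if "x \<in> carrier ?P" "y \<in> carrier ?P" for x y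
    using rep[OF that(1)] rep[OF that(2)] cls by (metis mult_presented_group words_append)
  show "x \<otimes>\<^bsub>?P\<^esub> y \<otimes>\<^bsub>?P\<^esub> z = x \<otimes>\<^bsub>?P\<^esub> (y \<otimes>\<^bsub>?P\<^esub> z)"
    if "x \<in> carrier ?P" "y \<in> carrier ?P" "z \<in> carrier ?P" for x y z
    using rep[OF that(1)] rep[OF that(2)] rep[OF that(3)]
    by (metis mult_presented_group words_append append_assoc)
  show "\<one>\<^bsub>?P\<^esub> \<otimes>\<^bsub>?P\<^esub> x = x" if "x \<in> carrier ?P" for x
    using rep[OF that] unfolding one by (metis mult_presented_group words_Nil append_Nil)
  show "\<exists>y\<in>carrier ?P. y \<otimes>\<^bsub>?P\<^esub> x = \<one>\<^bsub>?P\<^esub>" if x: "x \<in> carrier ?P" for x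
  proof -
    obtain w where w: "w \<in> words S" "x = word_class S R w"
      using rep[OF x] by blast
    obtain w' where w': "w' \<in> words S" "(w' @ w, []) \<in> word_cong S R"
      using word_inverse[OF w(1)] by blast
    have "word_class S R w' \<otimes>\<^bsub>?P\<^esub> x = \<one>\<^bsub>?P\<^esub>"
      using w w' by (simp add: one mult_presented_group word_class_eq_iff)
    then show ?thesis
      using cls[OF w'(1)] by blast
  qed
qed

section \<open>Cayley graphs\<close>

text \<open>Undirected simple graphs are represented as symmetric digraphs without loops whose arcs are
  ordered pairs of vertices.\<close>

definition cayley_graph :: "('g, 'm) monoid_scheme \<Rightarrow> 'g set \<Rightarrow> ('g, 'g \<times> 'g) pre_digraph" where
  "cayley_graph \<Gamma> X =
    \<lparr>verts = carrier \<Gamma>,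
     arcs = {(g, h). g \<in> carrier \<Gamma> \<and> h \<in> carrier \<Gamma> \<and> g \<noteq> h \<and>
       (\<exists>x\<in>X. h = g \<otimes>\<^bsub>\<Gamma>\<^esub> x \<or> g = h \<otimes>\<^bsub>\<Gamma>\<^esub> x)},
     tail = fst, head = snd\<rparr>"

definition presentation_graph ::
  "'a set \<Rightarrow> 'a word set \<Rightarrow> ('a word set, 'a word set \<times> 'a word set) pre_digraph" where
  "presentation_graph S R = cayley_graph (presented_group S R) (generators S R)"

text \<open>The closed walk induced by the word \<open>r\<close> starting at \<open>g\<close>, as a list of arcs.\<close>

definition induced_walk ::
  "'a set \<Rightarrow> 'a word set \<Rightarrow> 'a word set \<Rightarrow> 'a word \<Rightarrow> ('a word set \<times> 'a word set) list" where
  "induced_walk S R g r =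
    map (\<lambda>i. (g \<otimes>\<^bsub>presented_group S R\<^esub> word_class S R (take i r),
              g \<otimes>\<^bsub>presented_group S R\<^esub> word_class S R (take (Suc i) r))) [0..<length r]"

text \<open>\<open>pre_digraph.cycle\<close> alone would also admit the walk back and forth along a single edge, which
  is a directed cycle of length 2 but not a cycle of the undirected graph.\<close>

definition undirected_cycle :: "('v, 'e) pre_digraph \<Rightarrow> 'e list \<Rightarrow> bool" where
  "undirected_cycle G c \<longleftrightarrow> pre_digraph.cycle G c \<and> length c \<ge> 3"

definition relators_induce_cycles :: "'a set \<Rightarrow> 'a word set \<Rightarrow> bool" where
  "relators_induce_cycles S R \<longleftrightarrow>
    (\<forall>g\<in>verts (presentation_graph S R). \<forall>r\<in>R.
      undirected_cycle (presentation_graph S R) (induced_walk S R g r))"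

definition longest_relator_cycle :: "'a set \<Rightarrow> 'a word set \<Rightarrow> nat" where
  "longest_relator_cycle S R =
    Max {length (induced_walk S R g r) | g r. g \<in> verts (presentation_graph S R) \<and> r \<in> R}"

text \<open>All vertices of a Cayley graph have the same degree, so it is read off at the identity.
  As both orientations of an edge are present, the out-degree is the undirected degree.\<close>

definition cayley_degree :: "'a set \<Rightarrow> 'a word set \<Rightarrow> nat" where
  "cayley_degree S R = out_degree (presentation_graph S R) \<one>\<^bsub>presented_group S R\<^esub>"

definition gamma_dot :: "'a set \<Rightarrow> 'a word set \<Rightarrow> real" where
  "gamma_dot S R = (real (cayley_degree S R) ^ (longest_relator_cycle S R div 2) - 1) * exp 1"

section \<open>Components and ends\<close>

text \<open>Empty if \<open>v\<close> is not a vertex of \<open>G\<close>.\<close>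

definition component :: "('v, 'e) pre_digraph \<Rightarrow> 'v \<Rightarrow> 'v set" where
  "component G v = {w. v \<rightarrow>\<^sup>*\<^bsub>G\<^esub> w}"

definition one_ended :: "('v, 'e) pre_digraph \<Rightarrow> bool" where
  "one_ended G \<longleftrightarrow>
    (\<forall>K. K \<subseteq> verts G \<and> finite K \<longrightarrow>
      (\<exists>!C. C \<in> component (G \<restriction> (verts G - K)) ` (verts G - K) \<and> infinite C))"

section \<open>Bernoulli site percolation\<close>

definition site_percolation :: "('v, 'e) pre_digraph \<Rightarrow> real \<Rightarrow> ('v \<Rightarrow> bool) measure" where
  "site_percolation G p = Pi\<^sub>M (verts G) (\<lambda>_. measure_pmf (bernoulli_pmf p))"

definition cluster :: "('v, 'e) pre_digraph \<Rightarrow> 'v \<Rightarrow> ('v \<Rightarrow> bool) \<Rightarrow> 'v set" where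
  "cluster G v \<omega> = component (G \<restriction> {u \<in> verts G. \<omega> u}) v"

definition theta :: "('v, 'e) pre_digraph \<Rightarrow> 'v \<Rightarrow> real \<Rightarrow> real" where
  "theta G v p = measure (site_percolation G p)
    {\<omega> \<in> space (site_percolation G p). infinite (cluster G v \<omega>)}"

text \<open>Agreement is only demanded on \<open>I\<close>, so at an endpoint belonging to \<open>I\<close> the condition is
  one-sided.\<close>

definition real_analytic_on :: "(real \<Rightarrow> real) \<Rightarrow> real set \<Rightarrow> bool" where
  "real_analytic_on f I \<longleftrightarrow>
    (\<forall>x\<in>I. \<exists>r>0. \<exists>F. F holomorphic_on ball (complex_of_real x) r \<and>
      (\<forall>y\<in>I. complex_of_real y \<in> ball (complex_of_real x) r \<longrightarrow>
        F (complex_of_real y) = complex_of_real (f y)))"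

definition p_analytic :: "('v, 'e) pre_digraph \<Rightarrow> 'v \<Rightarrow> real" where
  "p_analytic G v = Inf {p. 0 \<le> p \<and> p \<le> 1 \<and> real_analytic_on (theta G v) {p<..1}}"

end

(* Interfaces. For an occupied vertex v0, the cluster of v0 is finite iff v0 is surrounded by an
   interface: a set of edges from occupied to vacant vertices that forms the edge boundary of a finite
   set containing v0 and is one class of the relation linking the two ends of an occupied arc of a
   relator cycle. Existence: by invariance of a crossing parity under the relations of the group, the
   class of an edge from a finite cluster to the unbounded component of its complement is a cut.
   Interfaces are local, and the vacant sets of different interfaces of one configuration are disjoint.

   Counting. Vertices on a common relator cycle are at distance at most m = t div 2, so the vacant set of
   an interface is connected in the m-th power of the graph, whose degree is at most D = d ^ m. There are
   at most const * ((D - 1) e) ^ n connected n-sets containing a given vertex, and a vacant set of n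
   vertices that surrounds v0 meets one of quadratically many vertices of a geodesic through v0.

   Analyticity. Expand the probability that v0 is occupied and no interface occurs by inclusion and
   exclusion. By disjointness, for complex z near p the term of a family of interfaces is bounded by a
   product of factors ((1 + epsilon) |1 - z|) ^ n, where n is the number of vacant vertices, so the
   expansion is dominated by the product of 1 + ((1 + epsilon) |1 - z|) ^ n over all interfaces, which
   converges when 1 - p < 1 / ((D - 1) e). *)

theory Submission
  imports Defs "HOL-Complex_Analysis.Complex_Analysis"
begin

section \<open>Bernoulli sums at complex parameters\<close>

text \<open>The obstacle is that at complex z the weights no longer form a probability: the total
  absolute mass of n independent sites is (|z| + |1 - z|)^n, which grows with n off the segment
  [0,1]. A term of the expansion can only be controlled if its event is read off from a window whose
  size is proportional to the number of vacant vertices that pay for it. Hence interfaces must be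
  local, with the m-neighbourhood of the vacant set as window, and their vacant sets must be
  disjoint, since only then do the payments of a family add up. The inflation per vacant vertex is a
  fixed power of |z| + |1 - z|, which tends to 1 at the segment; this is the source of epsilon. The
  rate (D - 1) e bounds the inverse of the weight q (1 - q)^(D - 2) per vertex of an animal at q =
  1/D, namely D (1 + 1/(D - 1))^(D - 2) = (D - 1) (1 + 1/(D - 1))^(D - 1). Polynomial factors do not
  affect the radius of convergence, so the diameter of an interface may be estimated
  crudely.\<close>

text \<open>For real p in [0,1] this is the expectation of \<open>f\<close> applied to the occupied
  part of the window \<open>N\<close>. As a polynomial in \<open>z\<close> it also makes sense at
  complex parameters; the ring-valued type lets both cases share the algebra.\<close>

definition bernoulli_sum :: "'b::comm_ring_1 \<Rightarrow> 'v set \<Rightarrow> ('v set \<Rightarrow> 'b) \<Rightarrow> 'b" where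
  "bernoulli_sum z N f = (\<Sum>Y\<in>Pow N. f Y * (z ^ card Y * (1 - z) ^ card (N - Y)))"

lemma bernoulli_sum_cong:
  "(\<And>Y. Y \<subseteq> N \<Longrightarrow> f Y = g Y) \<Longrightarrow> bernoulli_sum z N f = bernoulli_sum z N g"
  unfolding bernoulli_sum_def by (intro sum.cong) auto

text \<open>Condition on the state of the site \<open>x\<close>.\<close>

lemma bernoulli_sum_insert:
  assumes "finite N" "x \<notin> N"
  shows "bernoulli_sum z (insert x N) f =
    (1 - z) * bernoulli_sum z N f + z * bernoulli_sum z N (\<lambda>Y. f (insert x Y))"
proof -
  let ?w = "\<lambda>M Y. z ^ card Y * (1 - z) ^ card (M - Y)"
  have inj: "inj_on (insert x) (Pow N)"
    using assms(2) by (fastforce simp: inj_on_def)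
  have w0: "?w (insert x N) Y = (1 - z) * ?w N Y" if "Y \<subseteq> N" for Y
  proof -
    have "insert x N - Y = insert x (N - Y)" using that assms(2) by auto
    then show ?thesis using assms by (simp add: algebra_simps)
  qed
  have w1: "?w (insert x N) (insert x Y) = z * ?w N Y" if "Y \<subseteq> N" for Y
  proof -
    have "insert x N - insert x Y = N - Y" "card (insert x Y) = Suc (card Y)"
      using that assms by (auto simp: finite_subset card_insert_if)
    then show ?thesis by (simp add: algebra_simps)
  qed
  have "bernoulli_sum z (insert x N) f =
      (\<Sum>Y\<in>Pow N. f Y * ?w (insert x N) Y) + (\<Sum>Y\<in>insert x ` Pow N. f Y * ?w (insert x N) Y)"
    unfolding bernoulli_sum_def Pow_insert
    by (rule sum.union_disjoint) (use assms in auto)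
  also have "(\<Sum>Y\<in>insert x ` Pow N. f Y * ?w (insert x N) Y) =
      (\<Sum>Y\<in>Pow N. f (insert x Y) * ?w (insert x N) (insert x Y))"
    by (simp add: sum.reindex[OF inj])
  also have "(\<Sum>Y\<in>Pow N. f Y * ?w (insert x N) Y) = (1 - z) * bernoulli_sum z N f"
    unfolding bernoulli_sum_def sum_distrib_left
    by (intro sum.cong HOL.refl) (simp only: PowD w0 mult_ac)
  also have "(\<Sum>Y\<in>Pow N. f (insert x Y) * ?w (insert x N) (insert x Y)) =
      z * bernoulli_sum z N (\<lambda>Y. f (insert x Y))"
    unfolding bernoulli_sum_def sum_distrib_left
    by (intro sum.cong HOL.refl) (simp only: PowD w1 mult_ac)
  finally show ?thesis .
qed

text \<open>A site that \<open>f\<close> does not see is summed out through (1 - z) + z = 1, an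
  identity valid at complex \<open>z\<close> too.\<close>

lemma bernoulli_sum_restrict:
  assumes "finite N" "N' \<subseteq> N" "\<And>Y. Y \<subseteq> N \<Longrightarrow> f Y = f (Y \<inter> N')"
  shows "bernoulli_sum z N f = bernoulli_sum z N' f"
proof -
  have "bernoulli_sum z (N' \<union> D) f = bernoulli_sum z N' f" if "finite D" "D \<subseteq> N - N'" for D
    using that
  proof (induction D)
    case (insert x D)
    have fin: "finite (N' \<union> D)" using assms insert finite_subset by auto
    have "f (insert x Y) = f Y" if "Y \<subseteq> N' \<union> D" for Y
    proof -
      have "insert x Y \<inter> N' = Y \<inter> N'" using insert.prems by auto
      moreover have "insert x Y \<subseteq> N" "Y \<subseteq> N" using that insert.prems assms(2) by auto
      ultimately show ?thesis using assms(3) by metis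
    qed
    then have "bernoulli_sum z (N' \<union> D) (\<lambda>Y. f (insert x Y)) = bernoulli_sum z (N' \<union> D) f"
      by (intro bernoulli_sum_cong) auto
    moreover have "x \<notin> N' \<union> D" using insert by auto
    ultimately have "bernoulli_sum z (insert x (N' \<union> D)) f = bernoulli_sum z (N' \<union> D) f"
      using bernoulli_sum_insert[OF fin, of x z f] by (simp add: algebra_simps)
    then show ?case using insert by simp
  qed simp
  from this[of "N - N'"] show ?thesis
    using assms(1,2) by (simp add: Un_absorb1)
qed

lemma bernoulli_sum_cylinder:
  assumes "finite C" "finite D" "C \<inter> D = {}"
  shows "bernoulli_sum z (C \<union> D) (\<lambda>Y. of_bool (C \<subseteq> Y \<and> Y \<inter> D = {})) =
    z ^ card C * (1 - z) ^ card D"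
proof -
  have "bernoulli_sum z (C \<union> D) (\<lambda>Y. of_bool (C \<subseteq> Y \<and> Y \<inter> D = {})) =
     (\<Sum>Y\<in>Pow (C \<union> D). if Y = C then z ^ card C * (1 - z) ^ card D else 0)"
    unfolding bernoulli_sum_def
  proof (intro sum.cong HOL.refl)
    fix Y assume "Y \<in> Pow (C \<union> D)"
    then have "C \<subseteq> Y \<and> Y \<inter> D = {} \<longleftrightarrow> Y = C" using assms(3) by auto
    moreover have "C \<union> D - C = D" using assms(3) by auto
    ultimately show "of_bool (C \<subseteq> Y \<and> Y \<inter> D = {}) * (z ^ card Y * (1 - z) ^ card (C \<union> D - Y)) =
        (if Y = C then z ^ card C * (1 - z) ^ card D else 0)" by auto
  qed
  also have "\<dots> = z ^ card C * (1 - z) ^ card D"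
    using assms by (simp add: sum.delta)
  finally show ?thesis .
qed

lemma bernoulli_sum_one:
  assumes "finite N"
  shows "bernoulli_sum z N (\<lambda>_. 1) = 1"
  using bernoulli_sum_restrict[OF assms, of "{}" "\<lambda>_. 1" z] by (simp add: bernoulli_sum_def)

lemma bernoulli_sum_mono:
  fixes q :: real
  assumes "0 \<le> q" "q \<le> 1" "\<And>Y. Y \<subseteq> N \<Longrightarrow> f Y \<le> g Y"
  shows "bernoulli_sum q N f \<le> bernoulli_sum q N g"
  unfolding bernoulli_sum_def using assms by (intro sum_mono mult_right_mono) auto

lemma bernoulli_sum_sum:
  "bernoulli_sum z N (\<lambda>Y. \<Sum>i\<in>I. c i * f i Y) = (\<Sum>i\<in>I. c i * bernoulli_sum z N (f i))"
  unfolding bernoulli_sum_def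
  by (subst sum_distrib_right, subst sum.swap, simp only: sum_distrib_left mult.assoc)

text \<open>Each unconstrained site contributes the absolute mass |z| + |1 - z|. If \<open>f\<close>
  vanishes unless \<open>B\<close> is vacant, a site of \<open>B\<close> contributes only |1 -
  z|.\<close>

lemma norm_bernoulli_sum_le:
  fixes z :: complex
  assumes "finite N" "B \<subseteq> N" "\<And>Y. Y \<subseteq> N \<Longrightarrow> norm (f Y) \<le> of_bool (Y \<inter> B = {})"
  shows "norm (bernoulli_sum z N f) \<le>
    norm (1 - z) ^ card B * (norm z + norm (1 - z)) ^ card (N - B)"
proof -
  let ?w = "\<lambda>M Y. norm z ^ card Y * norm (1 - z) ^ card (M - Y)"
  have "norm (bernoulli_sum z N f) \<le> (\<Sum>Y\<in>Pow N. of_bool (Y \<inter> B = {}) * ?w N Y)"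
    unfolding bernoulli_sum_def
    by (rule order_trans[OF norm_sum], intro sum_mono)
      (simp only: norm_mult norm_power, intro mult_right_mono assms(3), auto)
  also have "\<dots> = (\<Sum>Y\<in>Pow (N - B). of_bool (Y \<inter> B = {}) * ?w N Y)"
    using assms(1) by (intro sum.mono_neutral_right) auto
  also have "\<dots> = (\<Sum>Y\<in>Pow (N - B). norm (1 - z) ^ card B * ?w (N - B) Y)"
  proof (intro sum.cong HOL.refl)
    fix Y assume Y: "Y \<in> Pow (N - B)"
    then have "N - Y = B \<union> (N - B - Y)" "Y \<inter> B = {}" using assms(2) by auto
    moreover have "card (B \<union> (N - B - Y)) = card B + card (N - B - Y)"
      using assms(1,2) finite_subset by (intro card_Un_disjoint) auto
    ultimately show "of_bool (Y \<inter> B = {}) * ?w N Y = norm (1 - z) ^ card B * ?w (N - B) Y"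
      by (simp add: power_add)
  qed
  also have "\<dots> = norm (1 - z) ^ card B * (norm z + norm (1 - z)) ^ card (N - B)"
    using prod_add[of "N - B" "\<lambda>_. norm z" "\<lambda>_. norm (1 - z)"] assms(1)
    by (simp add: sum_distrib_left)
  finally show ?thesis .
qed

lemma holomorphic_bernoulli_sum [holomorphic_intros]:
  "(\<lambda>z. bernoulli_sum z N f) holomorphic_on A"
  unfolding bernoulli_sum_def by (intro holomorphic_intros)

lemma bernoulli_sum_of_real:
  "bernoulli_sum (of_real p) N (\<lambda>Y. of_real (f Y)) =
     (of_real (bernoulli_sum p N f) :: 'b::{comm_ring_1,real_algebra_1})"
  unfolding bernoulli_sum_def by simp

text \<open>An event that looks at finitely many sites is a finite disjoint union of cylinders. Its
  probability is therefore a polynomial in p, which can be continued to complex parameters.\<close>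

lemma measure_bernoulli_product:
  fixes p :: real
  assumes "0 \<le> p" "p \<le> 1" "finite N" "N \<subseteq> V"
  defines "M \<equiv> Pi\<^sub>M V (\<lambda>_. measure_pmf (bernoulli_pmf p))"
  shows "{\<omega> \<in> space M. P ({x \<in> V. \<omega> x} \<inter> N)} \<in> sets M" (is ?sets)
    and "measure M {\<omega> \<in> space M. P ({x \<in> V. \<omega> x} \<inter> N)} =
      bernoulli_sum p N (\<lambda>Y. of_bool (P Y))" (is ?meas)
proof -
  interpret product_prob_space "\<lambda>_. measure_pmf (bernoulli_pmf p)" V
    by unfold_locales
  define A where "A Y = prod_emb V (\<lambda>_. measure_pmf (bernoulli_pmf p)) N
      (\<Pi>\<^sub>E x\<in>N. {x \<in> Y})" for Y
  have A: "A Y = {\<omega> \<in> space M. {x \<in> V. \<omega> x} \<inter> N = Y}" if "Y \<subseteq> N" for Y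
  proof -
    have "(\<forall>x\<in>N. \<omega> x = (x \<in> Y)) \<longleftrightarrow> {x \<in> V. \<omega> x} \<inter> N = Y" for \<omega>
    proof -
      have "(\<forall>x\<in>N. \<omega> x = (x \<in> Y)) \<longleftrightarrow> (\<forall>x. x \<in> V \<and> \<omega> x \<and> x \<in> N \<longleftrightarrow> x \<in> Y)"
        using that assms(4) by (metis subsetD)
      then show ?thesis by (auto simp: set_eq_iff)
    qed
    moreover have "restrict \<omega> N \<in> (\<Pi>\<^sub>E x\<in>N. {x \<in> Y}) \<longleftrightarrow> (\<forall>x\<in>N. \<omega> x = (x \<in> Y))" for \<omega>
      by (simp add: PiE_iff)
    ultimately have "\<omega> \<in> A Y \<longleftrightarrow> \<omega> \<in> {\<omega> \<in> space M. {x \<in> V. \<omega> x} \<inter> N = Y}" for \<omega>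
      unfolding A_def M_def prod_emb_def space_PiM Int_iff vimage_eq mem_Collect_eq
      by (simp only: conj_commute)
    then show ?thesis by (rule Set.set_eqI)
  qed
  have meas: "A Y \<in> sets M" for Y
    unfolding A_def M_def by (rule sets_PiM_I) (use assms in auto)
  have mA: "measure M (A Y) = p ^ card Y * (1 - p) ^ card (N - Y)" if "Y \<subseteq> N" for Y
  proof -
    have "measure M (A Y) = (\<Prod>x\<in>N. measure (measure_pmf (bernoulli_pmf p)) {x \<in> Y})"
      unfolding A_def M_def by (rule measure_PiM_emb) (use assms in auto)
    also have "\<dots> = (\<Prod>x\<in>N. if x \<in> Y then p else 1 - p)"
      using assms(1,2) by (intro prod.cong HOL.refl) (simp add: measure_pmf_single)
    also have "\<dots> = p ^ card Y * (1 - p) ^ card (N - Y)"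
      using that assms(3) by (simp add: prod.If_cases Int_absorb1 Diff_eq)
    finally show ?thesis .
  qed
  have un: "{\<omega> \<in> space M. P ({x \<in> V. \<omega> x} \<inter> N)} = (\<Union>Y\<in>{Y\<in>Pow N. P Y}. A Y)"
    using A by auto
  show ?sets unfolding un using assms(3) meas by (intro sets.finite_UN) auto
  have "measure M (\<Union>Y\<in>{Y\<in>Pow N. P Y}. A Y) = (\<Sum>Y\<in>{Y\<in>Pow N. P Y}. measure M (A Y))"
  proof (rule finite_measure.finite_measure_finite_Union)
    show "finite_measure M" unfolding M_def by unfold_locales
    show "disjoint_family_on A {Y \<in> Pow N. P Y}"
      using A by (auto simp: disjoint_family_on_def)
  qed (use assms(3) meas in auto)
  also have "\<dots> = (\<Sum>Y\<in>Pow N. if P Y then measure M (A Y) else 0)"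
    using assms(3) by (simp add: sum.If_cases Int_def)
  also have "\<dots> = bernoulli_sum p N (\<lambda>Y. of_bool (P Y))"
    unfolding bernoulli_sum_def using mA by (intro sum.cong) auto
  finally show ?meas unfolding un .
qed

section \<open>Inclusion and exclusion for local vacant events\<close>

text \<open>What the expansion needs from interfaces: \<open>nbhd B\<close> is the window that
  decides whether \<open>B\<close> occurs, \<open>card_nbhd\<close> keeps it linear in the number of
  vacant sites, and \<open>disjoint\<close> makes the vacant sites of jointly occurring members add
  up.\<close>

locale polymer_system =
  fixes V :: "'v set" and v0 :: 'v and \<B> :: "'v set set"
    and occurs :: "'v set \<Rightarrow> 'v set \<Rightarrow> bool" and nbhd :: "'v set \<Rightarrow> 'v set" and K :: nat
  assumes v0: "v0 \<in> V"
    and nbhd: "B \<in> \<B> \<Longrightarrow> finite (nbhd B) \<and> B \<subseteq> nbhd B \<and> nbhd B \<subseteq> V"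
    and card_nbhd: "B \<in> \<B> \<Longrightarrow> card (nbhd B) \<le> K * card B"
    and local: "B \<in> \<B> \<Longrightarrow> occurs B Y \<longleftrightarrow> occurs B (Y \<inter> nbhd B)"
    and vacant: "B \<in> \<B> \<Longrightarrow> occurs B Y \<Longrightarrow> Y \<inter> B = {}"
    and disjoint: "B \<in> \<B> \<Longrightarrow> B' \<in> \<B> \<Longrightarrow> occurs B Y \<Longrightarrow> occurs B' Y \<Longrightarrow> B \<noteq> B' \<Longrightarrow> B \<inter> B' = {}"
    and finite_size: "finite {B \<in> \<B>. card B = n}"
begin

section \<open>Truncated avoidance probabilities and their expansion\<close>

text \<open>\<open>v0\<close> is included because its own occupation is part of every event.\<close>

definition supp :: "'v set set \<Rightarrow> 'v set" where
  "supp M = insert v0 (\<Union>B\<in>M. nbhd B)"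

definition joint :: "'v set set \<Rightarrow> complex \<Rightarrow> complex" where
  "joint M z = bernoulli_sum z (supp M) (\<lambda>Y. of_bool (v0 \<in> Y \<and> (\<forall>B\<in>M. occurs B Y)))"

definition level :: "nat \<Rightarrow> 'v set set" where
  "level n = {B \<in> \<B>. card B < n}"

definition avoid :: "nat \<Rightarrow> 'v set \<Rightarrow> bool" where
  "avoid n Y \<longleftrightarrow> v0 \<in> Y \<and> (\<forall>B\<in>level n. \<not> occurs B Y)"

definition approx :: "nat \<Rightarrow> complex \<Rightarrow> complex" where
  "approx n z = bernoulli_sum z (supp (level n)) (\<lambda>Y. of_bool (avoid n Y))"

lemma finite_level: "finite (level n)"
proof -
  have "level n = (\<Union>i<n. {B \<in> \<B>. card B = i})" by (auto simp: level_def)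
  then show ?thesis using finite_size by simp
qed

lemma finite_supp: "finite M \<Longrightarrow> M \<subseteq> \<B> \<Longrightarrow> finite (supp M)"
  unfolding supp_def using nbhd by auto

lemma supp_subset: "M \<subseteq> \<B> \<Longrightarrow> supp M \<subseteq> V"
  unfolding supp_def using nbhd v0 by auto

lemma occurs_Int: "B \<in> \<B> \<Longrightarrow> nbhd B \<subseteq> N \<Longrightarrow> occurs B (Y \<inter> N) \<longleftrightarrow> occurs B Y"
  using local[of B "Y \<inter> N"] local[of B Y] by (simp add: Int_assoc Int_absorb1)

text \<open>Expand the product of the factors 1 - [B occurs] over \<open>level n\<close> and sum
  term by term.\<close>

lemma approx_expand: "approx n z = (\<Sum>M\<in>Pow (level n). (-1) ^ card M * joint M z)"
proof -
  let ?N = "supp (level n)"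
  have sub: "level n \<subseteq> \<B>" by (auto simp: level_def)
  have ex: "of_bool (avoid n Y) = (\<Sum>M\<in>Pow (level n).
      (-1) ^ card M * (of_bool (v0 \<in> Y \<and> (\<forall>B\<in>M. occurs B Y)) :: complex))" for Y
  proof -
    have "of_bool (avoid n Y) =
        of_bool (v0 \<in> Y) * (\<Prod>B\<in>level n. 1 - (of_bool (occurs B Y) :: complex))"
      using finite_level unfolding avoid_def by (auto simp: prod_zero_iff)
    also have "\<dots> = of_bool (v0 \<in> Y) * (\<Sum>M\<in>Pow (level n). (-1) ^ card M * (\<Prod>B\<in>M. of_bool (occurs B Y)))"
      by (simp add: prod_diff_conv_sum[OF finite_level])
    also have "\<dots> = (\<Sum>M\<in>Pow (level n). (-1) ^ card M * of_bool (v0 \<in> Y \<and> (\<forall>B\<in>M. occurs B Y)))"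
      unfolding sum_distrib_left
    proof (rule sum.cong[OF HOL.refl])
      fix M assume "M \<in> Pow (level n)"
      then have "finite M" using finite_level finite_subset by auto
      then have "(\<Prod>B\<in>M. of_bool (occurs B Y)) = (of_bool (\<forall>B\<in>M. occurs B Y) :: complex)"
        by (induction M) auto
      then show "of_bool (v0 \<in> Y) * ((-1) ^ card M * (\<Prod>B\<in>M. of_bool (occurs B Y))) =
          (-1) ^ card M * (of_bool (v0 \<in> Y \<and> (\<forall>B\<in>M. occurs B Y)) :: complex)"
        by simp
    qed
    finally show ?thesis .
  qed
  have "approx n z = (\<Sum>M\<in>Pow (level n). (-1) ^ card M *
      bernoulli_sum z ?N (\<lambda>Y. of_bool (v0 \<in> Y \<and> (\<forall>B\<in>M. occurs B Y))))"
    unfolding approx_def ex by (rule bernoulli_sum_sum)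
  also have "\<dots> = (\<Sum>M\<in>Pow (level n). (-1) ^ card M * joint M z)"
  proof (rule sum.cong[OF HOL.refl])
    fix M assume M: "M \<in> Pow (level n)"
    \<comment> \<open>Each term moves from the common window to its own support, so its size no
      longer depends on \<open>n\<close>.\<close>
    have "bernoulli_sum z ?N (\<lambda>Y. of_bool (v0 \<in> Y \<and> (\<forall>B\<in>M. occurs B Y))) = joint M z"
      unfolding joint_def
    proof (rule bernoulli_sum_restrict)
      show "finite ?N" by (rule finite_supp[OF finite_level sub])
      show "supp M \<subseteq> ?N" using M by (auto simp: supp_def)
      fix Y
      have "occurs B (Y \<inter> supp M) \<longleftrightarrow> occurs B Y" if "B \<in> M" for B
        using that M sub by (intro occurs_Int) (auto simp: supp_def)
      then show "of_bool (v0 \<in> Y \<and> (\<forall>B\<in>M. occurs B Y)) =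
         of_bool (v0 \<in> Y \<inter> supp M \<and> (\<forall>B\<in>M. occurs B (Y \<inter> supp M)))"
        by (simp add: supp_def)
    qed
    then show "(-1) ^ card M * bernoulli_sum z ?N (\<lambda>Y. of_bool (v0 \<in> Y \<and> (\<forall>B\<in>M. occurs B Y))) =
        (-1) ^ card M * joint M z" by simp
  qed
  finally show ?thesis .
qed

text \<open>Overlapping members cannot occur together, so such a family contributes 0. For a
  disjoint family with c vacant sites the rest of the window has at most 1 + K c sites, and the
  inflation of K sites per vacant one is absorbed into \<open>r\<close>.\<close>

lemma norm_joint_le:
  assumes M: "finite M" "M \<subseteq> \<B>" and r: "norm (1 - z) * (norm z + norm (1 - z)) ^ K \<le> r"
  shows "norm (joint M z) \<le> (norm z + norm (1 - z)) * (\<Prod>B\<in>M. r ^ card B)"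
proof -
  let ?s = "norm z + norm (1 - z)"
  have s1: "?s \<ge> 1"
    using norm_triangle_ineq[of z "1 - z"] by simp
  have r0: "r \<ge> 0" using r s1 by (smt (verit) mult_nonneg_nonneg norm_ge_zero zero_le_power)
  show ?thesis
  proof (cases "\<forall>B\<in>M. \<forall>B'\<in>M. B \<noteq> B' \<longrightarrow> B \<inter> B' = {}")
    case False
    then obtain B B' where "B \<in> M" "B' \<in> M" "B \<noteq> B'" "B \<inter> B' \<noteq> {}" by auto
    then have "\<not> (\<forall>B\<in>M. occurs B Y)" for Y
      using disjoint[of B B' Y] M(2) by blast
    then have "joint M z = 0"
      unfolding joint_def bernoulli_sum_def by (intro sum.neutral) auto
    then show ?thesis using s1 r0 by (simp add: prod_nonneg)
  next
    case True
    define c where "c = (\<Sum>B\<in>M. card B)"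
    have fin: "finite B" if "B \<in> M" for B
      using nbhd[of B] that M(2) finite_subset by blast
    have cU: "card (\<Union>M) = c"
      unfolding c_def by (rule card_Union_disjoint) (use True fin in \<open>auto simp: pairwise_def disjnt_def\<close>)
    have "card (supp M - \<Union>M) \<le> card (supp M)"
      using finite_supp[OF M] by (intro card_mono) auto
    \<comment> \<open>The extra site is \<open>v0\<close>; it causes the prefactor |z| + |1 -
      z|.\<close>
    also have "\<dots> \<le> Suc (card (\<Union>B\<in>M. nbhd B))"
      unfolding supp_def by (rule card_insert_le_m1) auto
    also have "card (\<Union>B\<in>M. nbhd B) \<le> (\<Sum>B\<in>M. card (nbhd B))"
      by (rule card_UN_le[OF M(1)])
    also have "\<dots> \<le> (\<Sum>B\<in>M. K * card B)"
      using M(2) card_nbhd by (intro sum_mono) auto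
    finally have c: "card (supp M - \<Union>M) \<le> Suc (K * c)"
      by (simp add: c_def sum_distrib_left)
    have "norm (joint M z) \<le> norm (1 - z) ^ card (\<Union>M) * ?s ^ card (supp M - \<Union>M)"
      unfolding joint_def
    proof (rule norm_bernoulli_sum_le)
      show "finite (supp M)" by (rule finite_supp[OF M])
      show "\<Union>M \<subseteq> supp M" unfolding supp_def using nbhd M(2) by blast
      show "norm (of_bool (v0 \<in> Y \<and> (\<forall>B\<in>M. occurs B Y)) :: complex) \<le> of_bool (Y \<inter> \<Union>M = {})" for Y
        using vacant[of _ Y] M(2) by auto
    qed
    also have "\<dots> \<le> norm (1 - z) ^ c * ?s ^ Suc (K * c)"
      unfolding cU using s1 c by (intro mult_left_mono power_increasing) auto
    also have "\<dots> = ?s * (norm (1 - z) * ?s ^ K) ^ c"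
      by (simp add: power_mult_distrib power_mult)
    also have "\<dots> \<le> ?s * r ^ c"
      using r s1 by (intro mult_left_mono power_mono) auto
    also have "r ^ c = (\<Prod>B\<in>M. r ^ card B)"
      unfolding c_def by (rule power_sum)
    finally show ?thesis .
  qed
qed

section \<open>Uniform convergence of the truncations\<close>

text \<open>Only families not contained in \<open>level k\<close> survive in the difference. Apart
  from the prefactor the bound does not involve \<open>z\<close>, so the Cauchy property of the real
  products becomes uniform in \<open>z\<close>.\<close>

lemma dist_approx_le:
  assumes "k \<le> n" and r: "norm (1 - z) * (norm z + norm (1 - z)) ^ K \<le> r"
  shows "norm (approx n z - approx k z) \<le> (norm z + norm (1 - z)) *
    ((\<Prod>B\<in>level n. 1 + r ^ card B) - (\<Prod>B\<in>level k. 1 + r ^ card B))"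
proof -
  let ?s = "norm z + norm (1 - z)" and ?w = "\<lambda>M. \<Prod>B\<in>M. r ^ card B"
  have sub: "Pow (level k) \<subseteq> Pow (level n)" using assms(1) by (auto simp: level_def)
  have ex: "(\<Prod>B\<in>level j. 1 + r ^ card B) = (\<Sum>M\<in>Pow (level j). ?w M)" for j
    using prod_add[OF finite_level[of j], of "\<lambda>B. r ^ card B" "\<lambda>_. 1"] by (simp add: add.commute)
  have "approx n z - approx k z = (\<Sum>M\<in>Pow (level n) - Pow (level k). (-1) ^ card M * joint M z)"
    unfolding approx_expand using sub finite_level by (subst sum_diff) auto
  also have "norm \<dots> \<le> (\<Sum>M\<in>Pow (level n) - Pow (level k). ?s * ?w M)"
  proof (rule order_trans[OF norm_sum], intro sum_mono)
    fix M assume "M \<in> Pow (level n) - Pow (level k)"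
    then have "finite M" "M \<subseteq> \<B>" using finite_level[of n] finite_subset by (auto simp: level_def)
    then show "norm ((-1) ^ card M * joint M z) \<le> ?s * ?w M"
      using norm_joint_le[OF _ _ r] by (simp add: norm_mult norm_power)
  qed
  also have "\<dots> = ?s * ((\<Sum>M\<in>Pow (level n). ?w M) - (\<Sum>M\<in>Pow (level k). ?w M))"
    unfolding sum_distrib_left[symmetric] using sub finite_level by (subst sum_diff) auto
  finally show ?thesis unfolding ex .
qed

text \<open>The products increase, and 1 + x \<le> exp x bounds them by the exponential of the given
  series.\<close>

lemma convergent_level_prod:
  assumes r: "0 \<le> r" and sum: "summable (\<lambda>n. real (card {B \<in> \<B>. card B = n}) * r ^ n)"
  shows "convergent (\<lambda>n. \<Prod>B\<in>level n. 1 + r ^ card B)"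
proof (rule Bseq_mono_convergent)
  let ?a = "\<lambda>n. \<Prod>B\<in>level n. 1 + r ^ card B" and ?N = "\<lambda>i. {B \<in> \<B>. card B = i}"
  have pos: "?a n \<ge> 0" for n using r by (intro prod_nonneg) auto
  have "?a n \<le> exp (\<Sum>i. real (card (?N i)) * r ^ i)" for n
  proof -
    have "?a n \<le> exp (\<Sum>B\<in>level n. r ^ card B)"
      using r by (intro prod_le_exp_sum) auto
    also have "(\<Sum>B\<in>level n. r ^ card B) = (\<Sum>i<n. \<Sum>B\<in>?N i. r ^ card B)"
    proof -
      have "level n = (\<Union>i<n. ?N i)" by (auto simp: level_def)
      then show ?thesis using finite_size by (simp add: sum.UNION_disjoint disjoint_iff)
    qed
    also have "\<dots> = (\<Sum>i<n. real (card (?N i)) * r ^ i)" by simp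
    also have "\<dots> \<le> (\<Sum>i. real (card (?N i)) * r ^ i)"
      using r by (intro sum_le_suminf sum) auto
    finally show ?thesis by simp
  qed
  then show "Bseq ?a" using pos by (intro BseqI'[where K = "exp (\<Sum>i. real (card (?N i)) * r ^ i)"]) auto
  show "\<forall>m. \<forall>n\<ge>m. ?a m \<le> ?a n"
    using r finite_level by (intro allI impI prod_mono2) (auto simp: level_def)
qed

text \<open>The truncated events decrease to the full avoidance event, so continuity from above
  applies.\<close>

lemma approx_tendsto:
  fixes p :: real
  assumes p: "0 \<le> p" "p \<le> 1"
  defines "M \<equiv> Pi\<^sub>M V (\<lambda>_. measure_pmf (bernoulli_pmf p))"
  shows "(\<lambda>n. approx n (of_real p)) \<longlonglongrightarrow>
    of_real (measure M {\<omega> \<in> space M. v0 \<in> {x \<in> V. \<omega> x} \<and> (\<forall>B\<in>\<B>. \<not> occurs B {x \<in> V. \<omega> x})})"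
proof -
  let ?occ = "\<lambda>\<omega>. {x \<in> V. \<omega> x}"
  define A where "A n = {\<omega> \<in> space M. avoid n (?occ \<omega>)}" for n
  have sub: "level n \<subseteq> \<B>" for n by (auto simp: level_def)
  have loc: "avoid n (Y \<inter> supp (level n)) \<longleftrightarrow> avoid n Y" for n Y
  proof -
    have "occurs B (Y \<inter> supp (level n)) \<longleftrightarrow> occurs B Y" if "B \<in> level n" for B
      using that sub by (intro occurs_Int) (auto simp: supp_def)
    then show ?thesis by (auto simp: avoid_def supp_def)
  qed
  have A: "A n = {\<omega> \<in> space M. avoid n (?occ \<omega> \<inter> supp (level n))}" for n
    unfolding A_def loc ..
  note props = p finite_supp[OF finite_level sub] supp_subset[OF sub]
  have Am: "A n \<in> sets M" for n
    unfolding A M_def by (rule measure_bernoulli_product(1)[OF props])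
  have mA: "complex_of_real (measure M (A n)) = approx n (of_real p)" for n
  proof -
    have "measure M (A n) = bernoulli_sum p (supp (level n)) (\<lambda>Y. of_bool (avoid n Y))"
      unfolding A M_def by (rule measure_bernoulli_product(2)[OF props])
    moreover have "complex_of_real (of_bool P) = of_bool P" for P by simp
    ultimately show ?thesis
      unfolding approx_def by (simp only: bernoulli_sum_of_real[symmetric])
  qed
  have "(\<lambda>n. measure M (A n)) \<longlonglongrightarrow> measure M (\<Inter>n. A n)"
  proof (rule finite_measure.finite_Lim_measure_decseq)
    interpret product_prob_space "\<lambda>_. measure_pmf (bernoulli_pmf p)" V by unfold_locales
    show "finite_measure M" unfolding M_def by unfold_locales
    show "range A \<subseteq> sets M" using Am by auto
    show "decseq A" unfolding decseq_def A_def avoid_def level_def by fastforce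
  qed
  moreover have "(\<Inter>n. A n) = {\<omega> \<in> space M. v0 \<in> ?occ \<omega> \<and> (\<forall>B\<in>\<B>. \<not> occurs B (?occ \<omega>))}"
    unfolding A_def avoid_def level_def by blast
  ultimately have "(\<lambda>n. measure M (A n)) \<longlonglongrightarrow>
      measure M {\<omega> \<in> space M. v0 \<in> ?occ \<omega> \<and> (\<forall>B\<in>\<B>. \<not> occurs B (?occ \<omega>))}" by (simp only:)
  then show ?thesis
    unfolding mA[symmetric] by (rule tendsto_of_real)
qed

text \<open>At a real point x of [0,1] there is no inflation and the requirement is just 1 - x < 1 /
  \<gamma>. It survives on a small complex disc, where the limit of the polynomials
  \<open>approx n\<close> is holomorphic.\<close>

theorem real_analytic_on_avoidance:
  fixes \<gamma> :: real
  assumes \<gamma>: "\<gamma> \<ge> 1"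
    and sum: "\<And>r. 0 \<le> r \<Longrightarrow> r < 1 / \<gamma> \<Longrightarrow> summable (\<lambda>n. real (card {B \<in> \<B>. card B = n}) * r ^ n)"
    and \<theta>: "\<And>p. \<theta> p = measure (Pi\<^sub>M V (\<lambda>_. measure_pmf (bernoulli_pmf p)))
       {\<omega> \<in> space (Pi\<^sub>M V (\<lambda>_. measure_pmf (bernoulli_pmf p))).
         v0 \<in> {x \<in> V. \<omega> x} \<and> (\<forall>B\<in>\<B>. \<not> occurs B {x \<in> V. \<omega> x})}"
  shows "real_analytic_on \<theta> {1 - 1 / \<gamma><..1}"
  unfolding real_analytic_on_def
proof
  fix x assume x: "x \<in> {1 - 1 / \<gamma><..1}"
  have pos: "0 \<le> y" if "y \<in> {1 - 1 / \<gamma><..1}" for y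
  proof -
    have "1 / \<gamma> \<le> 1" using \<gamma> by simp
    then show ?thesis using that by simp
  qed
  let ?x = "complex_of_real x"
  let ?s = "\<lambda>z::complex. norm z + norm (1 - z)"
  let ?h = "\<lambda>z. norm (1 - z) * ?s z ^ K"
  \<comment> \<open>The gap between 1 - x and \<open>r\<close> leaves room for inflation in a disc;
    the gap between \<open>r\<close> and 1 / \<gamma> gives summability.\<close>
  obtain r where r: "1 - x < r" "r < 1 / \<gamma>"
    using dense[of "1 - x" "1 / \<gamma>"] x by auto
  have r0: "0 \<le> r" using x r by auto
  have n1: "norm (1 - ?x) = 1 - x"
    using x by (metis abs_of_nonneg diff_ge_0_iff_ge greaterThanAtMost_iff norm_of_real of_real_1 of_real_diff)
  have "?s ?x = 1" unfolding n1 using pos[OF x] by simp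
  \<comment> \<open>The 2 is an arbitrary bound above 1 that keeps the prefactor bounded on the
    disc.\<close>
  then have hx: "?h ?x < r" "?s ?x < 2" unfolding n1 using r by auto
  have "open {z. ?h z < r \<and> ?s z < 2}"
    by (intro open_Collect_conj open_Collect_less continuous_intros)
  moreover have "?x \<in> {z. ?h z < r \<and> ?s z < 2}" using hx by simp
  ultimately obtain \<rho> where \<rho>: "\<rho> > 0" "ball ?x \<rho> \<subseteq> {z. ?h z < r \<and> ?s z < 2}"
    by (rule openE)
  let ?a = "\<lambda>n. \<Prod>B\<in>level n. 1 + r ^ card B"
  have "Cauchy ?a"
    by (rule convergent_Cauchy[OF convergent_level_prod[OF r0 sum[OF r0 r(2)]]])
  have "uniformly_convergent_on (ball ?x \<rho>) approx"
  proof (rule Cauchy_uniformly_convergent, rule uniformly_Cauchy_onI')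
    fix \<epsilon> :: real assume "\<epsilon> > 0"
    then obtain M where M: "\<And>m n. m \<ge> M \<Longrightarrow> n \<ge> M \<Longrightarrow> dist (?a m) (?a n) < \<epsilon> / 2"
      using \<open>Cauchy ?a\<close> unfolding Cauchy_def by (meson half_gt_zero)
    show "\<exists>M. \<forall>z\<in>ball ?x \<rho>. \<forall>m\<ge>M. \<forall>n>m. dist (approx m z) (approx n z) < \<epsilon>"
    proof (intro exI[of _ M] ballI allI impI)
      fix z m n assume z: "z \<in> ball ?x \<rho>" and mn: "m \<ge> M" "n > m"
      have h: "?h z \<le> r" "?s z \<le> 2" using z \<rho>(2) by (auto intro: less_imp_le)
      have "dist (approx m z) (approx n z) = norm (approx n z - approx m z)"
        by (simp add: dist_norm norm_minus_commute)
      also have "\<dots> \<le> ?s z * (?a n - ?a m)"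
        by (rule dist_approx_le) (use mn h in auto)
      also have "\<dots> \<le> ?s z * dist (?a n) (?a m)"
        by (intro mult_left_mono) (auto simp: dist_real_def)
      also have "\<dots> \<le> 2 * dist (?a n) (?a m)"
        using h by (intro mult_right_mono) auto
      also have "\<dots> < \<epsilon>" using M[of n m] mn by auto
      finally show "dist (approx m z) (approx n z) < \<epsilon>" .
    qed
  qed
  then obtain F where F: "uniform_limit (ball ?x \<rho>) approx F sequentially"
    by (auto simp: uniformly_convergent_on_def)
  have hol: "F holomorphic_on ball ?x \<rho>"
  proof (rule holomorphic_uniform_sequence)
    show "approx n holomorphic_on ball ?x \<rho>" for n
      unfolding approx_def by (rule holomorphic_bernoulli_sum)
    fix z assume "z \<in> ball ?x \<rho>"
    then obtain d where "d > 0" "cball z d \<subseteq> ball ?x \<rho>"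
      using open_contains_cball open_ball by blast
    then show "\<exists>d>0. cball z d \<subseteq> ball ?x \<rho> \<and> uniform_limit (cball z d) approx F sequentially"
      using uniform_limit_on_subset[OF F] by blast
  qed auto
  have eq: "F (of_real y) = of_real (\<theta> y)"
    if "y \<in> {1 - 1 / \<gamma><..1}" "complex_of_real y \<in> ball ?x \<rho>" for y
  proof (rule LIMSEQ_unique)
    show "(\<lambda>n. approx n (of_real y)) \<longlonglongrightarrow> F (of_real y)"
      by (rule tendsto_uniform_limitI[OF F that(2)])
    show "(\<lambda>n. approx n (of_real y)) \<longlonglongrightarrow> of_real (\<theta> y)"
      unfolding \<theta> by (rule approx_tendsto) (use pos that in auto)
  qed
  show "\<exists>r>0. \<exists>F. F holomorphic_on ball ?x r \<and>
      (\<forall>y\<in>{1 - 1 / \<gamma><..1}. complex_of_real y \<in> ball ?x r \<longrightarrow> F (of_real y) = of_real (\<theta> y))"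
    by (intro exI[of _ \<rho>] exI[of _ F] conjI ballI impI \<rho>(1) hol eq)
qed

end

section \<open>Lattice animals\<close>

lemma rtrancl_exit:
  assumes "(x, y) \<in> r\<^sup>*" "x \<in> A" "y \<notin> A"
  obtains u w where "(u, w) \<in> r" "u \<in> A" "w \<notin> A"
  using assms by (induction rule: rtrancl_induct) auto

lemma relpow_reflcl_mono: "k \<le> l \<Longrightarrow> (r\<^sup>=) ^^ k \<subseteq> (r\<^sup>=) ^^ l"
proof (induction l rule: dec_induct)
  case (step l)
  have "(r\<^sup>=) ^^ l \<subseteq> (r\<^sup>=) ^^ Suc l" by auto
  then show ?case using step by blast
qed simp

lemma sym_relpow:
  assumes "Relation.sym r"
  shows "Relation.sym (r ^^ k)"
proof (induction k)
  case (Suc k)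
  show ?case
  proof (rule symI)
    fix x y assume "(x, y) \<in> r ^^ Suc k"
    then obtain u where "(x, u) \<in> r ^^ k" "(u, y) \<in> r" by auto
    then have "(y, u) \<in> r" "(u, x) \<in> r ^^ k" using Suc assms by (auto dest: symD)
    then show "(y, x) \<in> r ^^ Suc k" by (rule relpow_Suc_I2)
  qed
qed (simp add: sym_Id)

lemma relpow_relpow: "(x, y) \<in> ((r :: 'a rel) ^^ m) ^^ k \<Longrightarrow> (x, y) \<in> r ^^ (m * k)"
proof (induction k arbitrary: y)
  case (Suc k)
  then obtain u where "(x, u) \<in> (r ^^ m) ^^ k" "(u, y) \<in> r ^^ m" by auto
  then have "(x, y) \<in> r ^^ (m * k + m)" using Suc.IH by (blast intro: relpow_trans)
  then show ?case by (simp add: add.commute)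
qed simp

text \<open>Lattice animals of \<open>H\<close> rooted at \<open>v\<close>. The relation used later
  is reflexive, which is why degrees and boundaries below leave out the vertices themselves.\<close>

definition animals :: "'v rel \<Rightarrow> 'v set \<Rightarrow> 'v \<Rightarrow> nat \<Rightarrow> 'v set set" where
  "animals H V v n = {C. finite C \<and> card C = n \<and> C \<subseteq> V \<and> v \<in> C \<and> (\<forall>y\<in>C. (v, y) \<in> (Restr H C)\<^sup>*)}"

text \<open>A new vertex leaves the boundary and, being adjacent to an old one, adds at most
  \<open>D - 1\<close> vertices to it.\<close>

lemma card_animal_boundary_le:
  assumes "Relation.sym H" "D \<ge> 2"
    and deg: "\<And>x. x \<in> V \<Longrightarrow> finite (H `` {x}) \<and> card (H `` {x} - {x}) \<le> D"
    and C: "C \<in> animals H V v n"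
  shows "card (H `` C - C) \<le> (D - 2) * n + 2"
proof -
  have fC: "finite C" "card C = n" "C \<subseteq> V" "v \<in> C" "\<And>y. y \<in> C \<Longrightarrow> (v, y) \<in> (Restr H C)\<^sup>*"
    using C by (auto simp: animals_def)
  \<comment> \<open>\<open>C\<close> is grown from \<open>v\<close> one vertex at a time. The
    summand 2 makes the start exact: D = (D - 2) * 1 + 2.\<close>
  have "\<exists>A\<subseteq>C. v \<in> A \<and> card A = Suc k \<and> card (H `` A - A) \<le> (D - 2) * Suc k + 2" if "Suc k \<le> n" for k
    using that
  proof (induction k)
    case 0
    have "card (H `` {v} - {v}) \<le> D" using deg fC by auto
    then show ?case using fC assms(2) by (intro exI[of _ "{v}"]) auto
  next
    case (Suc k)
    then obtain A where A: "A \<subseteq> C" "v \<in> A" "card A = Suc k" "card (H `` A - A) \<le> (D - 2) * Suc k + 2"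
      by auto
    have "finite A" using A(1) fC(1) finite_subset by blast
    have "A \<noteq> C" using A Suc.prems fC(2) by auto
    then obtain y where y: "y \<in> C" "y \<notin> A" using A(1) by auto
    obtain u w where uw: "(u, w) \<in> Restr H C" "u \<in> A" "w \<notin> A"
      by (rule rtrancl_exit[OF fC(5)[OF y(1)] A(2) y(2)])
    have fin: "finite (H `` A)"
    proof -
      have "H `` A = (\<Union>a\<in>A. H `` {a})" by auto
      then show ?thesis using \<open>finite A\<close> deg A(1) fC(3) by auto
    qed
    have w: "w \<in> H `` A - A" using uw by auto
    have Vw: "w \<in> V" using uw fC(3) by auto
    have "(w, u) \<in> H" using uw assms(1) by (auto dest: symD)
    then have u: "u \<in> H `` {w} - {w}" using uw by auto
    have "H `` insert w A - insert w A \<subseteq> (H `` A - A - {w}) \<union> (H `` {w} - {w} - {u})"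
      using uw(2) by auto
    then have "card (H `` insert w A - insert w A) \<le> card ((H `` A - A - {w}) \<union> (H `` {w} - {w} - {u}))"
      using fin deg[OF Vw] by (intro card_mono) auto
    also have "\<dots> \<le> card (H `` A - A - {w}) + card (H `` {w} - {w} - {u})"
      by (rule card_Un_le)
    also have "card (H `` A - A - {w}) = card (H `` A - A) - 1"
      using w fin by (simp add: card_Diff_singleton)
    also have "card (H `` {w} - {w} - {u}) = card (H `` {w} - {w}) - 1"
      using u by (rule card_Diff_singleton)
    also have "card (H `` A - A) - 1 + (card (H `` {w} - {w}) - 1) \<le> (D - 2) * Suc k + 1 + (D - 1)"
    proof -
      have "card (H `` {w} - {w}) \<le> D" using deg[OF Vw] by simp
      then show ?thesis using A(4) by linarith
    qed
    also have "\<dots> = (D - 2) * Suc (Suc k) + 2"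
      using assms(2) by (auto simp: algebra_simps dest!: le_Suc_ex)
    finally show ?case
      using A uw \<open>finite A\<close> by (intro exI[of _ "insert w A"]) auto
  qed
  from this[of "n - 1"] obtain A where A: "A \<subseteq> C" "card A = n" "card (H `` A - A) \<le> (D - 2) * n + 2"
    using fC card_gt_0_iff[of C] by (metis Suc_pred' emptyE order_refl)
  moreover have "A = C" using A fC by (simp add: card_subset_eq)
  ultimately show ?thesis by simp
qed

text \<open>For site percolation with parameter \<open>q\<close>, the events that the cluster of \<open>v\<close> equals a given
  animal are disjoint, so their probabilities sum to at most one. The choice \<open>q = 1 / D\<close> gives
  the exponential rate \<open>(D - 1) * e\<close>.\<close>

lemma card_animals_le:
  assumes H: "Relation.sym H" "D \<ge> 2"
    and deg: "\<And>x. x \<in> V \<Longrightarrow> finite (H `` {x}) \<and> card (H `` {x} - {x}) \<le> D"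
  shows "finite (animals H V v n)" "real (card (animals H V v n)) \<le> 4 * ((real D - 1) * exp 1) ^ n"
proof -
  define q :: real where "q = 1 / D"
  define w where "w = q ^ n * (1 - q) ^ ((D - 2) * n + 2)"
  have q: "0 < q" "q < 1" "q \<le> 1 / 2" using H(2) by (auto simp: q_def field_simps)
  have w0: "0 < w" using q by (simp add: w_def)
  have fin_bd: "finite (H `` C)" if "C \<in> animals H V v n" for C
  proof -
    have "H `` C = (\<Union>a\<in>C. H `` {a})" by auto
    then show ?thesis using that deg by (auto simp: animals_def)
  qed
  \<comment> \<open>Finite subfamilies come first; the uniform bound on their size yields finiteness
    of the whole family.\<close>
  have le: "real (card G) * w \<le> 1" if G: "G \<subseteq> animals H V v n" "finite G" for G
  proof -
    define N where "N = (\<Union>C\<in>G. C \<union> H `` C)"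
    define ev where "ev C Y \<longleftrightarrow> C \<subseteq> Y \<and> Y \<inter> (H `` C - C) = {}" for C Y
    have finN: "finite N" unfolding N_def using G fin_bd by (auto simp: animals_def)
    have each: "w \<le> bernoulli_sum q N (\<lambda>Y. of_bool (ev C Y))" if "C \<in> G" for C
    proof -
      have C: "C \<in> animals H V v n" using that G by auto
      then have fC: "finite C" "card C = n" by (auto simp: animals_def)
      let ?D = "H `` C - C"
      have "w \<le> q ^ card C * (1 - q) ^ card ?D"
        unfolding w_def fC(2) using q card_animal_boundary_le[OF H deg C]
        by (intro mult_left_mono power_decreasing) auto
      also have "\<dots> = bernoulli_sum q (C \<union> ?D) (\<lambda>Y. of_bool (C \<subseteq> Y \<and> Y \<inter> ?D = {}))"
        by (rule bernoulli_sum_cylinder[symmetric]) (use fC fin_bd[OF C] in auto)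
      also have "\<dots> = bernoulli_sum q N (\<lambda>Y. of_bool (C \<subseteq> Y \<and> Y \<inter> ?D = {}))"
      proof (rule bernoulli_sum_restrict[symmetric])
        show "C \<union> ?D \<subseteq> N" unfolding N_def using that by auto
        show "of_bool (C \<subseteq> Y \<and> Y \<inter> ?D = {}) =
            of_bool (C \<subseteq> Y \<inter> (C \<union> ?D) \<and> Y \<inter> (C \<union> ?D) \<inter> ?D = {})" for Y
          by (rule arg_cong[of _ _ of_bool]) auto
      qed (rule finN)
      finally show ?thesis unfolding ev_def .
    qed
    \<comment> \<open>A path in \<open>C'\<close> from the common vertex \<open>v\<close> that
      leaves \<open>C\<close> enters the boundary of \<open>C\<close>, which would be vacant and
      occupied at once.\<close>
    have sub: "C' \<subseteq> C" if "C \<in> G" "C' \<in> G" "ev C Y" "ev C' Y" for C C' Y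
    proof (rule ccontr)
      assume "\<not> C' \<subseteq> C"
      then obtain y where y: "y \<in> C'" "y \<notin> C" by auto
      have a: "v \<in> C" "(v, y) \<in> (Restr H C')\<^sup>*"
        using that G y by (auto simp: animals_def)
      obtain u w where "(u, w) \<in> Restr H C'" "u \<in> C" "w \<notin> C"
        by (rule rtrancl_exit[OF a(2) a(1) y(2)])
      then show False using that(3,4) unfolding ev_def by auto
    qed
    have one: "(\<Sum>C\<in>G. of_bool (ev C Y)) \<le> (1 :: real)" for Y
    proof (cases "\<exists>C\<in>G. ev C Y")
      case True
      then obtain C where C: "C \<in> G" "ev C Y" by auto
      have "of_bool (ev C' Y) = (if C' = C then 1 else (0 :: real))" if "C' \<in> G" for C'
        using sub[OF C(1) that C(2)] sub[OF that C(1) _ C(2)] C by auto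
      then have "(\<Sum>C'\<in>G. of_bool (ev C' Y)) = (\<Sum>C'\<in>G. if C' = C then 1 else (0 :: real))"
        by (rule sum.cong[OF HOL.refl])
      then show ?thesis using G(2) C(1) by simp
    next
      case False
      then have "(\<Sum>C\<in>G. of_bool (ev C Y)) = (0 :: real)" by (intro sum.neutral) auto
      then show ?thesis by simp
    qed
    have "real (card G) * w = (\<Sum>C\<in>G. 1 * w)" by simp
    also have "\<dots> \<le> (\<Sum>C\<in>G. 1 * bernoulli_sum q N (\<lambda>Y. of_bool (ev C Y)))"
      using each by (intro sum_mono) auto
    also have "\<dots> = bernoulli_sum q N (\<lambda>Y. \<Sum>C\<in>G. 1 * of_bool (ev C Y))"
      by (rule bernoulli_sum_sum[symmetric])
    also have "\<dots> \<le> bernoulli_sum q N (\<lambda>_. 1)"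
      using q one by (intro bernoulli_sum_mono) auto
    also have "\<dots> = 1" by (rule bernoulli_sum_one[OF finN])
    finally show ?thesis .
  qed
  have "finite (animals H V v n) \<and> card (animals H V v n) \<le> nat \<lfloor>1 / w\<rfloor>"
  proof (rule finite_if_finite_subsets_card_bdd)
    fix G assume "G \<subseteq> animals H V v n" "finite G"
    then show "card G \<le> nat \<lfloor>1 / w\<rfloor>"
      using le w0 by (simp add: le_nat_floor field_simps)
  qed
  then show fin: "finite (animals H V v n)" by simp
  have "real (card (animals H V v n)) \<le> 1 / w"
    using le[OF order.refl fin] w0 by (simp add: field_simps)
  also have "1 / w \<le> 4 * ((real D - 1) * exp 1) ^ n"
  proof -
    \<comment> \<open>Chosen so that 1 / (1 - q) = 1 + x. The summand 2 of the boundary bound leaves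
      a factor (1 + x)^2, which is at most 4 because D \<ge> 2.\<close>
    define x where "x = 1 / (real D - 1)"
    have x: "x > 0" using H(2) by (simp add: x_def)
    have iq: "1 / (1 - q) = 1 + x" using H(2) by (simp add: q_def x_def field_simps)
    have D: "real D = (real D - 1) * (1 + x)" using H(2) by (simp add: x_def field_simps)
    have "1 / w = (1 / q) ^ n * (1 / (1 - q)) ^ ((D - 2) * n + 2)"
      by (simp add: w_def power_divide)
    also have "\<dots> = (real D * (1 + x) ^ (D - 2)) ^ n * (1 + x)\<^sup>2"
      unfolding iq power_add power_mult power_mult_distrib by (simp add: q_def)
    also have "\<dots> \<le> ((real D - 1) * exp 1) ^ n * 2\<^sup>2"
    proof (rule mult_mono[OF power_mono power_mono])
      have "real D * (1 + x) ^ (D - 2) = (real D - 1) * (1 + x) ^ Suc (D - 2)"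
        by (subst D) simp
      also have "\<dots> \<le> (real D - 1) * exp x ^ Suc (D - 2)"
        using x H(2) by (intro mult_left_mono power_mono exp_ge_add_one_self) auto
      also have "exp x ^ Suc (D - 2) = exp (real (Suc (D - 2)) * x)"
        by (rule exp_of_nat_mult[symmetric])
      also have "real (Suc (D - 2)) * x = 1"
        using H(2) by (simp add: x_def of_nat_diff)
      finally show "real D * (1 + x) ^ (D - 2) \<le> (real D - 1) * exp 1" .
      show "1 + x \<le> 2" using H(2) by (simp add: x_def field_simps)
    qed (use x H(2) in auto)
    finally show ?thesis by (simp add: mult_ac)
  qed
  finally show "real (card (animals H V v n)) \<le> 4 * ((real D - 1) * exp 1) ^ n" .
qed

section \<open>Interfaces\<close>

text \<open>A cycle is given by its length and a periodic parametrisation. Simple connectivity with respect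
  to \<open>Z\<close> enters through the assumption \<open>cut\<close>: an edge set which is a coboundary (of a potential
  \<open>h\<close>) along every cycle in \<open>Z\<close> is a coboundary of the whole graph.\<close>

locale cycle_graph =
  fixes V :: "'v set" and E :: "'v rel" and Z :: "(nat \<times> (nat \<Rightarrow> 'v)) set"
    and m d :: nat and v0 :: 'v
  assumes E_subset: "E \<subseteq> V \<times> V"
    and E_sym: "(x, y) \<in> E \<Longrightarrow> (y, x) \<in> E"
    and infinite_V: "infinite V"
    and v0: "v0 \<in> V"
    and degree: "x \<in> V \<Longrightarrow> finite (E `` {x}) \<and> card (E `` {x}) \<le> d"
    and connected: "x \<in> V \<Longrightarrow> y \<in> V \<Longrightarrow> (x, y) \<in> E\<^sup>*"
    and d: "2 \<le> d" and m: "1 \<le> m"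
    and cycle_in_V: "(L, z) \<in> Z \<Longrightarrow> z i \<in> V"
    and cycle_period: "(L, z) \<in> Z \<Longrightarrow> 0 < L \<and> z (i + L) = z i"
    and cycle_step: "(L, z) \<in> Z \<Longrightarrow> (z i, z (Suc i)) \<in> E\<^sup>="
    and cycle_near: "(L, z) \<in> Z \<Longrightarrow> (z i, z j) \<in> (E\<^sup>=) ^^ m"
    and cut: "(\<And>x y. F x y \<Longrightarrow> F y x \<and> (x, y) \<in> E) \<Longrightarrow>
      (\<And>L z. (L, z) \<in> Z \<Longrightarrow>
        \<exists>h :: nat \<Rightarrow> bool. (\<forall>i. F (z i) (z (Suc i)) \<longleftrightarrow> h i \<noteq> h (Suc i)) \<and> h L = h 0) \<Longrightarrow>
      \<exists>X\<subseteq>V. v0 \<in> X \<and> (\<forall>(x, y)\<in>E. F x y \<longleftrightarrow> (x \<in> X) \<noteq> (y \<in> X))"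
    and one_end: "finite C \<Longrightarrow> C \<subseteq> V \<Longrightarrow>
      \<exists>!U. U \<in> (\<lambda>x. (Restr E (V - C))\<^sup>* `` {x}) ` (V - C) \<and> infinite U"
    and geodesic: "x \<in> V \<Longrightarrow> \<exists>g :: nat \<Rightarrow> 'v. g l = x \<and> (\<forall>i<2 * l. (g i, g (Suc i)) \<in> E) \<and>
      (\<forall>i j k. i \<le> j \<and> j \<le> 2 * l \<and> (g i, g j) \<in> (E\<^sup>=) ^^ k \<longrightarrow> j - i \<le> k)"
begin

section \<open>Balls and their growth\<close>

text \<open>Steps of the reflexive closure may stand still, so this is the relation of distance at
  most \<open>k\<close>.\<close>

abbreviation near :: "nat \<Rightarrow> 'v rel" where
  "near k \<equiv> (E\<^sup>=) ^^ k"

lemma sym_E: "Relation.sym E"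
  by (rule symI) (rule E_sym)

lemma near_sym: "(x, y) \<in> near k \<Longrightarrow> (y, x) \<in> near k"
  using sym_relpow[of "E\<^sup>=" k] sym_E by (auto dest: symD simp: sym_Un sym_Id)

lemma near_mono: "(x, y) \<in> near k \<Longrightarrow> k \<le> l \<Longrightarrow> (x, y) \<in> near l"
  using relpow_reflcl_mono by blast

lemma near_in_V: "(x, y) \<in> near k \<Longrightarrow> x \<in> V \<Longrightarrow> y \<in> V"
  by (induction k arbitrary: y) (use E_subset in auto)

lemma near_Suc_Image: "near (Suc k) `` {x} = near k `` {x} \<union> E `` (near k `` {x})"
  by auto

lemma finite_near: "x \<in> V \<Longrightarrow> finite (near k `` {x})"
proof (induction k)
  case (Suc k)
  have "E `` (near k `` {x}) = (\<Union>y\<in>near k `` {x}. E `` {y})" by auto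
  moreover have "y \<in> V" if "y \<in> near k `` {x}" for y using near_in_V that Suc.prems by auto
  ultimately show ?case unfolding near_Suc_Image using Suc degree by auto
qed simp

text \<open>Every vertex other than \<open>x\<close> has a neighbour closer to \<open>x\<close>, so it
  contributes at most \<open>d - 1\<close> vertices to the next sphere.\<close>

lemma card_near_le:
  assumes x: "x \<in> V" and k: "1 \<le> k"
  shows "card (near k `` {x} - {x}) \<le> d ^ k"
  using k
proof (induction k rule: dec_induct)
  case base
  have "near 1 `` {x} - {x} \<subseteq> E `` {x}" by auto
  then have "card (near 1 `` {x} - {x}) \<le> card (E `` {x})"
    using degree[OF x] by (intro card_mono) auto
  then show ?case using degree[OF x] by simp
next
  case (step k)
  let ?b = "\<lambda>k. near k `` {x}"
  \<comment> \<open>\<open>lev\<close> is the distance from \<open>x\<close>.\<close>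
  define lev where "lev u = (LEAST k. u \<in> ?b k)" for u
  have lev: "u \<in> ?b (lev u)" if "u \<in> ?b k" for u k
    unfolding lev_def by (rule LeastI[of _ k]) (rule that)
  have lev_le: "lev u \<le> k" if "u \<in> ?b k" for u k
    unfolding lev_def by (rule Least_le) (rule that)
  have ex_par: "\<exists>p. (u, p) \<in> E \<and> p \<in> ?b (lev u - 1)" if u: "u \<in> ?b k - {x}" for u k
  proof -
    have "lev u \<noteq> 0" using lev[of u k] u by (cases "lev u") auto
    then obtain l where l: "lev u = Suc l" by (cases "lev u") auto
    have "u \<notin> ?b l" using lev_le[of u l] l by auto
    moreover have "u \<in> ?b (Suc l)" using lev[of u k] u l by auto
    ultimately obtain p where "p \<in> ?b l" "(p, u) \<in> E" unfolding near_Suc_Image by auto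
    then show ?thesis using E_sym l by auto
  qed
  define par where "par u = (SOME p. (u, p) \<in> E \<and> p \<in> ?b (lev u - 1))" for u
  have par: "(u, par u) \<in> E" "par u \<in> ?b (lev u - 1)" if "u \<in> ?b k - {x}" for u k
    using someI_ex[OF ex_par[OF that]] unfolding par_def by auto
  let ?A = "?b k - {x}"
  \<comment> \<open>If \<open>w\<close> is not adjacent to \<open>x\<close>, let \<open>u\<close> be
    its predecessor on a shortest walk from \<open>x\<close>. The parent of \<open>u\<close> is
    closer to \<open>x\<close> than \<open>w\<close> is, so \<open>w\<close> is one of the other
    neighbours of \<open>u\<close>.\<close>
  have "?b (Suc k) - {x} \<subseteq> E `` {x} \<union> (\<Union>u\<in>?A. E `` {u} - {par u})"
  proof
    fix w assume w: "w \<in> ?b (Suc k) - {x}"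
    show "w \<in> E `` {x} \<union> (\<Union>u\<in>?A. E `` {u} - {par u})"
    proof (cases "w \<in> E `` {x}")
      case False
      have "lev w \<noteq> 0" using lev[of w "Suc k"] w by (cases "lev w") auto
      then obtain l where l: "lev w = Suc l" by (cases "lev w") auto
      have "w \<notin> ?b l" using lev_le[of w l] l by auto
      moreover have "w \<in> ?b (Suc l)" using lev[of w "Suc k"] w l by auto
      ultimately obtain u where u: "u \<in> ?b l" "(u, w) \<in> E" unfolding near_Suc_Image by auto
      have lk: "l \<le> k" using lev_le[of w "Suc k"] w l by auto
      have ux: "u \<noteq> x" using u False by auto
      have uA: "u \<in> ?A" using u(1) ux lk near_mono by auto
      have "lev u \<le> l" by (rule lev_le[OF u(1)])
      moreover have "lev u \<noteq> 0" using lev[OF u(1)] ux by (cases "lev u") auto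
      ultimately have "lev u - 1 < l" by auto
      then have "w \<noteq> par u" using lev_le[OF par(2)[OF uA]] l by auto
      then show ?thesis using uA u(2) by auto
    qed auto
  qed
  moreover have fA: "finite ?A" using finite_near[OF x] by auto
  moreover have AV: "u \<in> V" if "u \<in> ?A" for u using near_in_V x that by auto
  ultimately have "card (?b (Suc k) - {x}) \<le> card (E `` {x} \<union> (\<Union>u\<in>?A. E `` {u} - {par u}))"
    using degree x by (intro card_mono) auto
  also have "\<dots> \<le> card (E `` {x}) + card (\<Union>u\<in>?A. E `` {u} - {par u})"
    by (rule card_Un_le)
  also have "\<dots> \<le> d + (\<Sum>u\<in>?A. card (E `` {u} - {par u}))"
    using degree[OF x] by (intro add_mono card_UN_le fA) auto
  also have "(\<Sum>u\<in>?A. card (E `` {u} - {par u})) \<le> (\<Sum>u\<in>?A. d - 1)"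
  proof (intro sum_mono)
    fix u assume u: "u \<in> ?A"
    have "card (E `` {u} - {par u}) = card (E `` {u}) - 1"
      using par(1)[OF u] by (intro card_Diff_singleton) auto
    then show "card (E `` {u} - {par u}) \<le> d - 1" using degree[OF AV[OF u]] by auto
  qed
  \<comment> \<open>\<open>?A\<close> has at most d^k elements by the induction hypothesis, and d
    \<le> d^k because 1 \<le> k.\<close>
  also have "d + (\<Sum>u\<in>?A. d - 1) \<le> d ^ k + d ^ k * (d - 1)"
    using step d by (intro add_mono) (auto intro: self_le_power)
  also have "\<dots> = d ^ k * (1 + (d - 1))" by (simp only: distrib_left mult_1_right)
  also have "\<dots> = d ^ Suc k" using d by simp
  finally show ?case by simp
qed

section \<open>Boundary edges, link classes and interfaces\<close>

definition boundary_edges :: "'v set \<Rightarrow> 'v rel" where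
  "boundary_edges \<omega> = {(a, b) \<in> E. a \<in> \<omega> \<and> b \<notin> \<omega>}"

text \<open>Two boundary edges are linked if they are the two ends of a maximal occupied arc of a cycle.\<close>

definition linked :: "'v set \<Rightarrow> ('v \<times> 'v) rel" where
  "linked \<omega> = {((z (Suc i), z i), (z j, z (Suc j))) | L z i j. (L, z) \<in> Z \<and> i < j \<and>
     z i \<notin> \<omega> \<and> (\<forall>k. i < k \<and> k \<le> j \<longrightarrow> z k \<in> \<omega>) \<and> z (Suc j) \<notin> \<omega>}"

definition link_class :: "'v set \<Rightarrow> 'v \<times> 'v \<Rightarrow> 'v rel" where
  "link_class \<omega> e = (linked \<omega> \<union> (linked \<omega>)\<inverse>)\<^sup>* `` {e}"

definition outward :: "'v set \<Rightarrow> 'v rel" where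
  "outward X = {(x, y) \<in> E. x \<in> X \<and> y \<notin> X}"

text \<open>The inside \<open>X\<close> need not be the cluster of \<open>v0\<close>: it may contain
  vacant holes and further clusters. Asking for a single link class is what keeps different
  interfaces of one configuration apart.\<close>

definition interface :: "'v set \<Rightarrow> 'v set \<Rightarrow> bool" where
  "interface X \<omega> \<longleftrightarrow> finite X \<and> X \<subseteq> V \<and> v0 \<in> X \<and>
     (\<exists>e\<in>boundary_edges \<omega>. outward X = link_class \<omega> e)"

text \<open>Interfaces are indexed by their sets of vacant vertices, because these are pairwise disjoint for
  the interfaces of one configuration.\<close>

definition occurs :: "'v set \<Rightarrow> 'v set \<Rightarrow> bool" where
  "occurs B \<omega> \<longleftrightarrow> (\<exists>X. interface X \<omega> \<and> B = snd ` outward X)"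

lemma linkedI:
  "(L, z) \<in> Z \<Longrightarrow> i < j \<Longrightarrow> z i \<notin> \<omega> \<Longrightarrow> \<forall>k. i < k \<and> k \<le> j \<longrightarrow> z k \<in> \<omega> \<Longrightarrow> z (Suc j) \<notin> \<omega> \<Longrightarrow>
   ((z (Suc i), z i), (z j, z (Suc j))) \<in> linked \<omega>"
  unfolding linked_def by blast

lemma linkedE:
  assumes "(e, e') \<in> linked \<omega>"
  obtains L z i j where "(L, z) \<in> Z" "i < j" "z i \<notin> \<omega>" "\<forall>k. i < k \<and> k \<le> j \<longrightarrow> z k \<in> \<omega>"
    "z (Suc j) \<notin> \<omega>" "e = (z (Suc i), z i)" "e' = (z j, z (Suc j))"
  using assms unfolding linked_def by blast

lemma linked_boundary:
  assumes "(e, e') \<in> linked \<omega>"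
  shows "e \<in> boundary_edges \<omega>" "e' \<in> boundary_edges \<omega>"
proof -
  obtain L z i j where z: "(L, z) \<in> Z" "i < j" "z i \<notin> \<omega>" "\<forall>k. i < k \<and> k \<le> j \<longrightarrow> z k \<in> \<omega>"
    "z (Suc j) \<notin> \<omega>" "e = (z (Suc i), z i)" "e' = (z j, z (Suc j))"
    using assms by (rule linkedE)
  have "z (Suc i) \<in> \<omega>" "z j \<in> \<omega>" using z by auto
  then show "e \<in> boundary_edges \<omega>" "e' \<in> boundary_edges \<omega>"
    using z cycle_step[OF z(1), of i] cycle_step[OF z(1), of j] E_sym
    unfolding boundary_edges_def by auto
qed

lemma linked_tails:
  assumes "(e, e') \<in> linked \<omega>"
  shows "(fst e, fst e') \<in> (Restr E \<omega>)\<^sup>*"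
proof -
  obtain L z i j where z: "(L, z) \<in> Z" "i < j" "\<forall>k. i < k \<and> k \<le> j \<longrightarrow> z k \<in> \<omega>"
    "e = (z (Suc i), z i)" "e' = (z j, z (Suc j))"
    using assms by (rule linkedE)
  have "(z (Suc i), z k) \<in> (Restr E \<omega>)\<^sup>*" if "Suc i \<le> k" "k \<le> j" for k
    using that
  proof (induction k rule: dec_induct)
    case (step k)
    have "z k \<in> \<omega>" "z (Suc k) \<in> \<omega>" using z(3) step by auto
    then have "(z k, z (Suc k)) \<in> (Restr E \<omega>)\<^sup>*" using cycle_step[OF z(1), of k] by auto
    then show ?case using step by (auto intro: rtrancl_trans)
  qed simp
  then show ?thesis using z by auto
qed

text \<open>Both heads lie on one cycle of \<open>Z\<close>, whose vertices are pairwise within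
  distance \<open>m\<close>.\<close>

lemma linked_heads: "(e, e') \<in> linked \<omega> \<Longrightarrow> (snd e, snd e') \<in> near m"
  by (erule linkedE) (simp add: cycle_near)

lemma sym_cluster: "(x, y) \<in> (Restr E \<omega>)\<^sup>* \<Longrightarrow> (y, x) \<in> (Restr E \<omega>)\<^sup>*"
proof -
  have "Relation.sym (Restr E \<omega>)" using E_sym by (auto intro!: symI)
  then show "(x, y) \<in> (Restr E \<omega>)\<^sup>* \<Longrightarrow> (y, x) \<in> (Restr E \<omega>)\<^sup>*"
    using sym_rtrancl symD by metis
qed

lemma link_class_refl: "e \<in> link_class \<omega> e"
  by (simp add: link_class_def)

lemma link_class_step:
  "e' \<in> link_class \<omega> e \<Longrightarrow> (e', e'') \<in> linked \<omega> \<or> (e'', e') \<in> linked \<omega> \<Longrightarrow> e'' \<in> link_class \<omega> e"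
  unfolding link_class_def by (auto intro: rtrancl_into_rtrancl)

lemma link_class_eq: "e' \<in> link_class \<omega> e \<Longrightarrow> link_class \<omega> e' = link_class \<omega> e"
proof -
  let ?r = "linked \<omega> \<union> (linked \<omega>)\<inverse>"
  assume "e' \<in> link_class \<omega> e"
  then have "(e, e') \<in> ?r\<^sup>*" by (simp add: link_class_def)
  moreover from this have "(e', e) \<in> ?r\<^sup>*"
    using sym_rtrancl[OF sym_Un_converse] by (rule symD[rotated])
  ultimately show ?thesis
    unfolding link_class_def by (auto intro: rtrancl_trans)
qed

lemma link_class_induct [consumes 1, case_names base step]:
  assumes "e' \<in> link_class \<omega> e" "P e"
    and "\<And>e' e''. e' \<in> link_class \<omega> e \<Longrightarrow> P e' \<Longrightarrow> (e', e'') \<in> linked \<omega> \<or> (e'', e') \<in> linked \<omega> \<Longrightarrow> P e''"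
  shows "P e'"
proof -
  have "(e, e') \<in> (linked \<omega> \<union> (linked \<omega>)\<inverse>)\<^sup>*" using assms(1) by (simp add: link_class_def)
  then show ?thesis
    by (induction rule: rtrancl_induct) (use assms(2,3) in \<open>auto simp: link_class_def\<close>)
qed

lemma link_class_boundary:
  "e' \<in> link_class \<omega> e \<Longrightarrow> e \<in> boundary_edges \<omega> \<Longrightarrow> e' \<in> boundary_edges \<omega>"
  by (induction rule: link_class_induct) (auto dest: linked_boundary)

lemma link_class_tails:
  "e' \<in> link_class \<omega> e \<Longrightarrow> (fst e, fst e') \<in> (Restr E \<omega>)\<^sup>*"
  by (induction rule: link_class_induct)
    (auto dest!: linked_tails dest: sym_cluster intro: rtrancl_trans)

lemma interface_boundary:
  assumes "interface X \<omega>" "(x, y) \<in> E" "x \<in> X" "y \<notin> X"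
  shows "x \<in> \<omega>" "y \<notin> \<omega>"
proof -
  obtain e where "e \<in> boundary_edges \<omega>" "outward X = link_class \<omega> e"
    using assms(1) by (auto simp: interface_def)
  moreover have "(x, y) \<in> outward X" using assms by (auto simp: outward_def)
  ultimately have "(x, y) \<in> boundary_edges \<omega>" using link_class_boundary by auto
  then show "x \<in> \<omega>" "y \<notin> \<omega>" by (auto simp: boundary_edges_def)
qed

text \<open>An occupied path leaving \<open>X\<close> would have to cross an outward edge, whose
  head is vacant.\<close>

lemma interface_cluster:
  assumes "interface X \<omega>" "(x, y) \<in> (Restr E \<omega>)\<^sup>*" "x \<in> X"
  shows "y \<in> X"
  using assms(2,3)
  by (induction rule: rtrancl_induct) (use interface_boundary[OF assms(1)] in auto)

lemma interface_tails:
  assumes "interface X \<omega>" "e \<in> outward X" "e' \<in> outward X"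
  shows "(fst e, fst e') \<in> (Restr E \<omega>)\<^sup>*"
proof -
  obtain e0 where "outward X = link_class \<omega> e0"
    using assms(1) by (auto simp: interface_def)
  then have "link_class \<omega> e = outward X" using link_class_eq assms(2) by auto
  then show ?thesis using link_class_tails assms(3) by auto
qed

lemma occurs_vacant: "occurs B \<omega> \<Longrightarrow> \<omega> \<inter> B = {}"
  unfolding occurs_def outward_def using interface_boundary(2) by auto

text \<open>If \<open>b\<close> is the head of edges of two different interfaces, then neither side contains the
  occupied cluster at the tails of the other one, so no edge can leave the intersection of the two
  sides.\<close>

lemma occurs_disjoint:
  assumes "occurs B1 \<omega>" "occurs B2 \<omega>" "B1 \<noteq> B2"
  shows "B1 \<inter> B2 = {}"
proof (rule ccontr)
  assume "B1 \<inter> B2 \<noteq> {}"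
  then obtain b where b: "b \<in> B1" "b \<in> B2" by auto
  obtain X1 X2 where X: "interface X1 \<omega>" "B1 = snd ` outward X1" "interface X2 \<omega>" "B2 = snd ` outward X2"
    using assms by (auto simp: occurs_def)
  have disj: "outward X1 \<inter> outward X2 = {}"
  proof (rule ccontr)
    assume "outward X1 \<inter> outward X2 \<noteq> {}"
    then obtain e where e: "e \<in> outward X1" "e \<in> outward X2" by auto
    have "outward X1 = link_class \<omega> e" "outward X2 = link_class \<omega> e"
      using X(1,3) e link_class_eq unfolding interface_def by metis+
    then show False using X assms(3) by simp
  qed
  have avoid: "x \<notin> X'"
    if X: "interface X \<omega>" "interface X' \<omega>" "outward X \<inter> outward X' = {}"
      "b \<in> snd ` outward X" "b \<in> snd ` outward X'" and xy: "(x, y) \<in> outward X" for X X' x y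
  proof
    assume x: "x \<in> X'"
    obtain a where a: "(a, b) \<in> outward X" using X(4) by auto
    have "(x, a) \<in> (Restr E \<omega>)\<^sup>*" using interface_tails[OF X(1) xy a] by simp
    then have "a \<in> X'" using interface_cluster[OF X(2)] x by blast
    then have "(a, b) \<in> outward X'" using a X(5) by (auto simp: outward_def)
    then show False using a X(3) by auto
  qed
  \<comment> \<open>Since the graph is infinite and connected, some edge leaves the finite set
    \<open>X1 \<inter> X2\<close>. It is outward for one of the sides, while its tail lies in
    both.\<close>
  have "finite (X1 \<inter> X2)" "v0 \<in> X1 \<inter> X2" using X by (auto simp: interface_def)
  then obtain y where y: "y \<in> V" "y \<notin> X1 \<inter> X2"
    using infinite_imp_nonempty[OF Diff_infinite_finite[OF _ infinite_V]] by blast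
  obtain u w where uw: "(u, w) \<in> E" "u \<in> X1 \<inter> X2" "w \<notin> X1 \<inter> X2"
    by (rule rtrancl_exit[OF connected[OF v0 y(1)] \<open>v0 \<in> X1 \<inter> X2\<close> y(2)])
  then consider "(u, w) \<in> outward X1" | "(u, w) \<in> outward X2" by (auto simp: outward_def)
  then show False
  proof cases
    case 1
    show False using avoid[OF X(1,3) disj _ _ 1] b X(2,4) uw(2) by simp
  next
    case 2
    show False using avoid[OF X(3,1) _ _ _ 2] disj b X(2,4) uw(2) by (simp add: Int_commute)
  qed
qed

section \<open>Locality of interfaces\<close>

text \<open>Radius \<open>m\<close> suffices because every cycle of \<open>Z\<close> through a
  vacant head stays within distance \<open>m\<close> of that head.\<close>

definition nbhd :: "'v set \<Rightarrow> 'v set" where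
  "nbhd B = near m `` B"

text \<open>Whether an edge is linked to a member of the class is decided on cycles through the head
  of that member, which lie in the window. So the class grows from \<open>e\<close> in the same way
  in both configurations.\<close>

lemma interface_local:
  assumes X: "interface X \<omega>" and eq: "\<omega> \<inter> nbhd (snd ` outward X) = \<omega>' \<inter> nbhd (snd ` outward X)"
  shows "interface X \<omega>'"
proof -
  let ?N = "nbhd (snd ` outward X)"
  have eq': "x \<in> \<omega> \<longleftrightarrow> x \<in> \<omega>'" if "x \<in> ?N" for x using eq that by blast
  obtain e where e: "e \<in> boundary_edges \<omega>" "outward X = link_class \<omega> e"
    using X by (auto simp: interface_def)
  have near: "x \<in> ?N" if "e' \<in> outward X" "(snd e', x) \<in> near m" for e' x
    using that by (auto simp: nbhd_def)
  have linked_iff: "(e', e'') \<in> linked \<omega> \<or> (e'', e') \<in> linked \<omega> \<longleftrightarrow> (e', e'') \<in> linked \<omega>' \<or> (e'', e') \<in> linked \<omega>'"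
    if e': "e' \<in> outward X" for e' e''
  proof -
    have "(f, f') \<in> linked \<omega>2"
      if "(f, f') \<in> linked \<omega>1" "e' = f \<or> e' = f'" "\<And>x. x \<in> ?N \<Longrightarrow> x \<in> \<omega>1 \<longleftrightarrow> x \<in> \<omega>2" for f f' \<omega>1 \<omega>2
      using that(1)
    proof (rule linkedE)
      fix L z i j assume z: "(L, z) \<in> Z" "i < j" "z i \<notin> \<omega>1" "\<forall>k. i < k \<and> k \<le> j \<longrightarrow> z k \<in> \<omega>1"
        "z (Suc j) \<notin> \<omega>1" "f = (z (Suc i), z i)" "f' = (z j, z (Suc j))"
      have "z k \<in> ?N" for k
        using that(2) z(6,7) cycle_near[OF z(1)] by (intro near[OF e']) auto
      then have "z k \<in> \<omega>1 \<longleftrightarrow> z k \<in> \<omega>2" for k using that(3) by blast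
      then show "(f, f') \<in> linked \<omega>2" using z by (auto intro!: linkedI)
    qed
    from this[of _ _ \<omega> \<omega>'] this[of _ _ \<omega>' \<omega>] show ?thesis using eq' by blast
  qed
  have "e \<in> outward X" using e(2) link_class_refl by simp
  then have "snd e \<in> ?N" "fst e \<in> ?N"
  proof -
    have "(snd e, snd e) \<in> near m" using near_mono[of _ _ 0 m] by simp
    then show "snd e \<in> ?N" by (rule near[OF \<open>e \<in> outward X\<close>])
    have "(snd e, fst e) \<in> E" using \<open>e \<in> outward X\<close> E_sym by (auto simp: outward_def)
    \<comment> \<open>Here 1 \<le> m ensures that the window also sees the tail of
      \<open>e\<close>.\<close>
    then have "(snd e, fst e) \<in> near m" using near_mono[of _ _ 1 m] m by simp
    then show "fst e \<in> ?N" by (rule near[OF \<open>e \<in> outward X\<close>])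
  qed
  then have e': "e \<in> boundary_edges \<omega>'" using e(1) eq' by (auto simp: boundary_edges_def)
  have "f \<in> outward X" if "f \<in> link_class \<omega>' e" for f
    using that
  proof (induction rule: link_class_induct)
    case (step e' e'')
    then show ?case using linked_iff e(2) link_class_step by metis
  qed (rule \<open>e \<in> outward X\<close>)
  moreover have "f \<in> link_class \<omega>' e" if "f \<in> link_class \<omega> e" for f
    using that
  proof (induction rule: link_class_induct)
    case (step e' e'')
    then show ?case using linked_iff e(2) link_class_step by metis
  qed (rule link_class_refl)
  ultimately have "outward X = link_class \<omega>' e" using e(2) by auto
  then show ?thesis using X e' by (auto simp: interface_def)
qed

lemma occurs_local: "occurs B (\<omega> \<inter> nbhd B) \<longleftrightarrow> occurs B \<omega>"
proof -
  have "\<omega> \<inter> nbhd B \<inter> nbhd B = \<omega> \<inter> nbhd B" by auto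
  then show ?thesis unfolding occurs_def using interface_local by metis
qed

end

section \<open>Clusters and the number of interfaces\<close>

lemma exists_last_step:
  fixes a b :: nat
  assumes "P a" "\<not> P b" "a \<le> b"
  obtains i where "a \<le> i" "i < b" "P i" "\<not> P (Suc i)"
proof -
  have "P b" if "\<forall>i. a \<le> i \<and> i < b \<and> P i \<longrightarrow> P (Suc i)"
    using assms(3) that by (induction b rule: dec_induct) (use assms(1) in auto)
  then show ?thesis using assms(2) that by blast
qed

lemma relpow_Restr: "(x, y) \<in> (Restr r A) ^^ k \<Longrightarrow> (x, y) \<in> r ^^ k"
  by (induction k arbitrary: y) auto

text \<open>Differentiating the geometric series twice gives the coefficients (n + 1) (n + 2), which
  dominate any such quadratic up to a constant.\<close>

lemma summable_quadratic_geometric: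
  fixes x :: real
  assumes "0 \<le> x" "x < 1"
  shows "summable (\<lambda>n. real (m * (n * n) + 1) * x ^ n)"
proof -
  have "summable (\<lambda>n. diffs (diffs (\<lambda>_. 1 :: real)) n * x ^ n)"
  proof (rule termdiff_converges[where K = 1])
    show "summable (\<lambda>n. diffs (\<lambda>_. 1) n * y ^ n)" if "norm y < 1" for y :: real
      using that by (intro termdiff_converges[where K = 1]) (auto intro: summable_geometric)
  qed (use assms in auto)
  then have "summable (\<lambda>n. real (m + 1) * (diffs (diffs (\<lambda>_. 1 :: real)) n * x ^ n))"
    by (rule summable_mult)
  then show ?thesis
  proof (rule summable_comparison_test')
    fix n :: nat
    have "m * (n * n) + 1 \<le> (m + 1) * (Suc n * Suc (Suc n))"
      by (simp add: algebra_simps)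
    then have "real (m * (n * n) + 1) \<le> real (m + 1) * (real (Suc n) * real (Suc (Suc n)))"
      by (metis of_nat_le_iff of_nat_mult)
    then have "real (m * (n * n) + 1) * x ^ n \<le> real (m + 1) * (real (Suc n) * real (Suc (Suc n))) * x ^ n"
      using assms by (intro mult_right_mono) auto
    then show "norm (real (m * (n * n) + 1) * x ^ n) \<le> real (m + 1) * (diffs (diffs (\<lambda>_. 1)) n * x ^ n)"
      using assms by (simp add: diffs_def mult.assoc)
  qed
qed

context cycle_graph begin

section \<open>Interfaces around finite clusters\<close>

lemma finite_E_Image: "finite C \<Longrightarrow> C \<subseteq> V \<Longrightarrow> finite (E `` C)"
proof -
  assume "finite C" "C \<subseteq> V"
  moreover have "E `` C = (\<Union>x\<in>C. E `` {x})" by auto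
  ultimately show ?thesis using degree by auto
qed

text \<open>By one-endedness all components of the complement of \<open>C\<close> but one are
  finite. By connectivity each of them contains a neighbour of \<open>C\<close>, and
  \<open>C\<close> has only finitely many neighbours.\<close>

lemma cofinite_component:
  assumes C: "finite C" "C \<subseteq> V" "v0 \<in> C"
  obtains x where "x \<in> V - C" "finite (V - (Restr E (V - C))\<^sup>* `` {x})"
proof -
  let ?comp = "\<lambda>x. (Restr E (V - C))\<^sup>* `` {x}"
  obtain U where U: "U \<in> ?comp ` (V - C)" "infinite U"
    "\<And>U'. U' \<in> ?comp ` (V - C) \<Longrightarrow> infinite U' \<Longrightarrow> U' = U"
    using one_end[OF C(1,2)] by blast
  obtain x where x: "x \<in> V - C" "U = ?comp x" using U(1) by auto
  have sub: "V - U \<subseteq> C \<union> (\<Union>y\<in>E `` C - C - U. ?comp y)"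
  proof
    fix w assume w: "w \<in> V - U"
    show "w \<in> C \<union> (\<Union>y\<in>E `` C - C - U. ?comp y)"
    proof (cases "w \<in> C")
      case False
      have in_V: "u \<in> V - C" if "(w, u) \<in> (Restr E (V - C))\<^sup>*" for u
        using that by (induction rule: rtrancl_induct) (use w False in auto)
      have "v0 \<notin> ?comp w" using in_V C(3) by auto
      obtain u c where uc: "(u, c) \<in> E" "u \<in> ?comp w" "c \<notin> ?comp w"
        using rtrancl_exit[OF connected, of w v0 "?comp w"] w v0 \<open>v0 \<notin> ?comp w\<close> by auto
      have u: "u \<in> V - C" using in_V uc(2) by auto
      have "c \<in> C"
      proof (rule ccontr)
        assume "c \<notin> C"
        then have "(u, c) \<in> Restr E (V - C)" using uc(1) u E_subset by auto
        then show False using uc(2,3) by (auto intro: rtrancl_into_rtrancl)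
      qed
      then have "u \<in> E `` C - C" using uc(1) u E_sym by auto
      moreover have wu: "w \<in> ?comp u" using uc(2) sym_cluster by auto
      moreover have "u \<notin> U" using wu w x(2) by (auto intro: rtrancl_trans)
      ultimately show ?thesis by auto
    qed auto
  qed
  have "finite (?comp y)" if "y \<in> E `` C - C - U" for y
    using U(3)[of "?comp y"] that E_subset by auto
  then have "finite (C \<union> (\<Union>y\<in>E `` C - C - U. ?comp y))"
    using C finite_E_Image[OF C(1,2)] by auto
  then have "finite (V - U)" using sub finite_subset by blast
  then show ?thesis using that x by blast
qed

text \<open>Along a cycle, the edges of a link class are exactly the places where membership in an
  occupied arc ending in that class changes.\<close>

lemma link_class_cycle_potential:
  assumes z: "(L, z) \<in> Z" and e: "e \<in> boundary_edges \<omega>"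
  shows "\<exists>h :: nat \<Rightarrow> bool. (\<forall>i. ((z i, z (Suc i)) \<in> link_class \<omega> e \<or> (z (Suc i), z i) \<in> link_class \<omega> e)
      \<longleftrightarrow> h i \<noteq> h (Suc i)) \<and> h L = h 0"
proof -
  let ?R = "link_class \<omega> e"
  \<comment> \<open>The sequence starts in an occupied run, and the edge by which it first exits
    this run belongs to the class. \<open>h i\<close> says this of the cycle read from position
    \<open>i\<close>.\<close>
  define Q where "Q s \<longleftrightarrow> s 0 \<in> \<omega> \<and> (\<exists>j. (\<forall>k\<le>j. s k \<in> \<omega>) \<and> s (Suc j) \<notin> \<omega> \<and> (s j, s (Suc j)) \<in> ?R)"
    for s :: "nat \<Rightarrow> 'v"
  define h where "h i = Q (\<lambda>k. z (i + k))" for i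
  have R: "x \<in> \<omega>" "y \<notin> \<omega>" if "(x, y) \<in> ?R" for x y
    using link_class_boundary[OF that e] by (auto simp: boundary_edges_def)
  have per: "z (i + L) = z i" for i using cycle_period[OF z] by blast
  have "h L = h 0"
    using per by (simp add: h_def add.commute)
  moreover have "((z i, z (Suc i)) \<in> ?R \<or> (z (Suc i), z i) \<in> ?R) \<longleftrightarrow> h i \<noteq> h (Suc i)" for i
  proof (cases "z i \<in> \<omega>"; cases "z (Suc i) \<in> \<omega>")
    assume a: "z i \<in> \<omega>" "z (Suc i) \<in> \<omega>"
    have "h i \<longleftrightarrow> h (Suc i)"
    proof
      assume "h i"
      then obtain j where j: "\<forall>k\<le>j. z (i + k) \<in> \<omega>" "z (i + Suc j) \<notin> \<omega>" "(z (i + j), z (i + Suc j)) \<in> ?R"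
        unfolding h_def Q_def by auto
      then obtain j' where j': "j = Suc j'" using a(2) by (cases j) auto
      have "z (Suc i + k) \<in> \<omega>" if "k \<le> j'" for k
        using j(1)[rule_format, of "Suc k"] that j' by simp
      then show "h (Suc i)" unfolding h_def Q_def using j j' a by (auto intro!: exI[of _ j'])
    next
      assume "h (Suc i)"
      then obtain j where j: "\<forall>k\<le>j. z (Suc i + k) \<in> \<omega>" "z (Suc i + Suc j) \<notin> \<omega>"
          "(z (Suc i + j), z (Suc i + Suc j)) \<in> ?R"
        unfolding h_def Q_def by auto
      have "z (i + k) \<in> \<omega>" if "k \<le> Suc j" for k
        using j(1)[rule_format, of "k - 1"] that a(1) by (cases k) auto
      then show "h i" unfolding h_def Q_def using j a by (auto intro!: exI[of _ "Suc j"])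
    qed
    then show ?thesis using R a by blast
  next
    assume a: "z i \<in> \<omega>" "z (Suc i) \<notin> \<omega>"
    have "h i \<longleftrightarrow> (z i, z (Suc i)) \<in> ?R"
    proof
      assume "h i"
      then obtain j where j: "\<forall>k\<le>j. z (i + k) \<in> \<omega>" "(z (i + j), z (i + Suc j)) \<in> ?R"
        unfolding h_def Q_def by auto
      have "j = 0" using j(1)[rule_format, of 1] a(2) by (cases j) auto
      then show "(z i, z (Suc i)) \<in> ?R" using j(2) by simp
    next
      assume "(z i, z (Suc i)) \<in> ?R"
      then show "h i" unfolding h_def Q_def using a by (auto intro!: exI[of _ 0])
    qed
    moreover have "\<not> h (Suc i)" using a by (simp add: h_def Q_def)
    ultimately show ?thesis using R a by blast
  next
    assume a: "z i \<notin> \<omega>" "z (Suc i) \<in> \<omega>"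
    \<comment> \<open>The edge by which the cycle enters an occupied arc is linked to the edge by
      which it exits, so both or neither belong to the class.\<close>
    have link: "((z (Suc i), z i), (z (Suc i + j), z (Suc i + Suc j))) \<in> linked \<omega>"
      if j: "\<forall>k\<le>j. z (Suc i + k) \<in> \<omega>" "z (Suc i + Suc j) \<notin> \<omega>" for j
    proof -
      have "z k \<in> \<omega>" if "i < k" "k \<le> Suc i + j" for k
        using j(1)[rule_format, of "k - Suc i"] that by simp
      then show ?thesis using linkedI[OF z, of i "Suc i + j" \<omega>] a(1) j(2) by simp
    qed
    have "h (Suc i) \<longleftrightarrow> (z (Suc i), z i) \<in> ?R"
    proof
      assume "h (Suc i)"
      then obtain j where j: "\<forall>k\<le>j. z (Suc i + k) \<in> \<omega>" "z (Suc i + Suc j) \<notin> \<omega>"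
          "(z (Suc i + j), z (Suc i + Suc j)) \<in> ?R"
        unfolding h_def Q_def by auto
      then show "(z (Suc i), z i) \<in> ?R" using link link_class_step by blast
    next
      assume zR: "(z (Suc i), z i) \<in> ?R"
      \<comment> \<open>The vacant vertex \<open>z i\<close> recurs after one period, so the arc
        starting at \<open>Suc i\<close> must end.\<close>
      have "Suc i + (L - 1) = i + L" using cycle_period[OF z, of 0] by simp
      then have "z (Suc i + (L - 1)) \<notin> \<omega>" using per[of i] a(1) by simp
      then have not_all: "\<not> (\<forall>k\<le>L - 1. z (Suc i + k) \<in> \<omega>)" by blast
      obtain j where j: "\<forall>k\<le>j. z (Suc i + k) \<in> \<omega>" "\<not> (\<forall>k\<le>Suc j. z (Suc i + k) \<in> \<omega>)"
        by (rule exists_last_step[of "\<lambda>j. \<forall>k\<le>j. z (Suc i + k) \<in> \<omega>" 0 "L - 1"])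
          (use a(2) not_all in auto)
      then have j': "\<forall>k\<le>j. z (Suc i + k) \<in> \<omega>" "z (Suc i + Suc j) \<notin> \<omega>"
        by (auto simp del: add_Suc_right simp: le_Suc_eq)
      then have "(z (Suc i + j), z (Suc i + Suc j)) \<in> ?R"
        using link link_class_step zR by blast
      then show "h (Suc i)" unfolding h_def Q_def using j' a by auto
    qed
    moreover have "\<not> h i" using a by (simp add: h_def Q_def)
    ultimately show ?thesis using R a by blast
  next
    assume a: "z i \<notin> \<omega>" "z (Suc i) \<notin> \<omega>"
    then have "\<not> h i" "\<not> h (Suc i)" by (simp_all add: h_def Q_def)
    then show ?thesis using R a by blast
  qed
  ultimately show ?thesis by (intro exI[of _ h]) simp
qed

text \<open>An occupied path cannot leave an interface. For the converse, the side \<open>X\<close>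
  supplied by \<open>cut\<close> contains the cluster \<open>C\<close> and misses the cofinite
  component \<open>U\<close>, which makes it finite.\<close>

theorem finite_cluster_iff_occurs:
  assumes "v0 \<in> \<omega>"
  shows "finite ((Restr E \<omega>)\<^sup>* `` {v0}) \<longleftrightarrow> (\<exists>B. occurs B \<omega>)"
proof
  assume "\<exists>B. occurs B \<omega>"
  then obtain X where X: "interface X \<omega>" by (auto simp: occurs_def)
  then have "(Restr E \<omega>)\<^sup>* `` {v0} \<subseteq> X" using interface_cluster[OF X] by (auto simp: interface_def)
  then show "finite ((Restr E \<omega>)\<^sup>* `` {v0})" using X finite_subset by (auto simp: interface_def)
next
  define C where "C = (Restr E \<omega>)\<^sup>* `` {v0}"
  assume "finite ((Restr E \<omega>)\<^sup>* `` {v0})"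
  then have finC: "finite C" by (simp add: C_def)
  have C_sub: "x \<in> V \<and> x \<in> \<omega>" if "x \<in> C" for x
  proof -
    have "(v0, x) \<in> (Restr E \<omega>)\<^sup>*" using that by (simp add: C_def)
    then show ?thesis by (induction rule: rtrancl_induct) (use v0 assms E_subset in auto)
  qed
  have v0C: "v0 \<in> C" by (simp add: C_def)
  obtain x where x: "x \<in> V - C" "finite (V - (Restr E (V - C))\<^sup>* `` {x})"
    using cofinite_component[OF finC _ v0C] C_sub by blast
  define U where "U = (Restr E (V - C))\<^sup>* `` {x}"
  have U_sub: "u \<in> V - C" if "u \<in> U" for u
  proof -
    have "(x, u) \<in> (Restr E (V - C))\<^sup>*" using that by (simp add: U_def)
    then show ?thesis by (induction rule: rtrancl_induct) (use x in auto)
  qed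
  have xU: "x \<in> U" by (simp add: U_def)
  have xV: "x \<in> V" and v0U: "v0 \<notin> U" using x U_sub v0C by auto
  obtain b1 a1 where e: "(b1, a1) \<in> E" "b1 \<in> U" "a1 \<notin> U"
    by (rule rtrancl_exit[OF connected[OF xV v0] xU v0U])
  have "a1 \<in> C"
  proof (rule ccontr)
    assume "a1 \<notin> C"
    then have "(b1, a1) \<in> Restr E (V - C)" using e(1) U_sub[OF e(2)] E_subset by auto
    then show False using e(2,3) unfolding U_def by (auto intro: rtrancl_into_rtrancl)
  qed
  have "b1 \<notin> \<omega>"
  proof
    assume "b1 \<in> \<omega>"
    then have "(a1, b1) \<in> Restr E \<omega>" using E_sym[OF e(1)] C_sub[OF \<open>a1 \<in> C\<close>] by auto
    then have "b1 \<in> C" using \<open>a1 \<in> C\<close> unfolding C_def by (auto intro: rtrancl_into_rtrancl)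
    then show False using U_sub[OF e(2)] by auto
  qed
  let ?e = "(a1, b1)"
  have e_bd: "?e \<in> boundary_edges \<omega>"
    using E_sym[OF e(1)] C_sub[OF \<open>a1 \<in> C\<close>] \<open>b1 \<notin> \<omega>\<close> by (auto simp: boundary_edges_def)
  let ?R = "link_class \<omega> ?e"
  define F where "F x y \<longleftrightarrow> (x, y) \<in> ?R \<or> (y, x) \<in> ?R" for x y
  have R: "(x, y) \<in> E" "x \<in> \<omega>" "y \<notin> \<omega>" if "(x, y) \<in> ?R" for x y
    using link_class_boundary[OF that e_bd] by (auto simp: boundary_edges_def)
  have tail: "x \<in> C" if "(x, y) \<in> ?R" for x y
    using link_class_tails[OF that] \<open>a1 \<in> C\<close> unfolding C_def by (auto intro: rtrancl_trans)
  have "\<exists>X\<subseteq>V. v0 \<in> X \<and> (\<forall>(x, y)\<in>E. F x y \<longleftrightarrow> (x \<in> X) \<noteq> (y \<in> X))"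
  proof (rule cut)
    show "F y x \<and> (x, y) \<in> E" if "F x y" for x y
      using that R(1) E_sym by (auto simp: F_def)
    show "\<exists>h :: nat \<Rightarrow> bool. (\<forall>i. F (z i) (z (Suc i)) \<longleftrightarrow> h i \<noteq> h (Suc i)) \<and> h L = h 0"
      if "(L, z) \<in> Z" for L z
      unfolding F_def by (rule link_class_cycle_potential[OF that e_bd])
  qed
  then obtain X where X: "X \<subseteq> V" "v0 \<in> X"
    and FX: "\<And>x y. (x, y) \<in> E \<Longrightarrow> F x y \<longleftrightarrow> (x \<in> X) \<noteq> (y \<in> X)" by blast
  \<comment> \<open>Every edge of the class has a vacant end, so none lies inside
    \<open>C\<close>.\<close>
  have CX: "y \<in> X" if "y \<in> C" for y
  proof -
    have "(v0, y) \<in> (Restr E \<omega>)\<^sup>*" using that by (simp add: C_def)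
    then show ?thesis
    proof (induction rule: rtrancl_induct)
      case (step y y')
      then have "\<not> F y y'" using R unfolding F_def by blast
      then show ?case using FX step by blast
    qed (rule X(2))
  qed
  \<comment> \<open>Tails of the class lie in \<open>C\<close>, so no edge inside \<open>U\<close>
    belongs to it, and all of \<open>U\<close> is on the side of \<open>b1\<close>.\<close>
  have UX: "y \<notin> X" if "y \<in> U" for y
  proof -
    have "(b1, x) \<in> (Restr E (V - C))\<^sup>*" using e(2) sym_cluster unfolding U_def by auto
    then have "(b1, y) \<in> (Restr E (V - C))\<^sup>*" using that unfolding U_def by (auto intro: rtrancl_trans)
    then show ?thesis
    proof (induction rule: rtrancl_induct)
      case base
      have "F a1 b1" by (simp add: F_def link_class_refl)
      then show ?case using FX[OF E_sym[OF e(1)]] CX[OF \<open>a1 \<in> C\<close>] by blast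
    next
      case (step y y')
      then have "\<not> F y y'" using tail unfolding F_def by blast
      then show ?case using FX step by blast
    qed
  qed
  have "outward X = ?R"
  proof (intro equalityI subsetI)
    fix f assume f: "f \<in> outward X"
    obtain p q where pq: "f = (p, q)" by force
    have "(p, q) \<in> E" "p \<in> X" "q \<notin> X" using f pq by (auto simp: outward_def)
    \<comment> \<open>Were the reversed edge in the class, its tail \<open>q\<close> would lie in
      \<open>C\<close> and hence in \<open>X\<close>.\<close>
    then have "F p q" "(q, p) \<notin> ?R" using FX tail CX by blast+
    then show "f \<in> ?R" using pq by (auto simp: F_def)
  next
    fix f assume f: "f \<in> ?R"
    obtain p q where pq: "f = (p, q)" by force
    have "p \<in> X" using tail f CX pq by blast
    moreover have "F p q" using f pq by (simp add: F_def)
    ultimately show "f \<in> outward X" using FX R(1) f pq by (auto simp: outward_def)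
  qed
  moreover have "finite X"
    by (rule finite_subset[OF _ x(2)]) (use X(1) UX in \<open>auto simp: U_def\<close>)
  ultimately have "interface X \<omega>" using X e_bd by (auto simp: interface_def)
  then show "\<exists>B. occurs B \<omega>" by (auto simp: occurs_def)
qed

section \<open>Connectivity and diameter of interfaces\<close>

lemma finite_outward: "finite X \<Longrightarrow> X \<subseteq> V \<Longrightarrow> finite (outward X)"
proof -
  assume X: "finite X" "X \<subseteq> V"
  have "outward X \<subseteq> Sigma X (\<lambda>x. E `` {x})" by (auto simp: outward_def)
  moreover have "finite (Sigma X (\<lambda>x. E `` {x}))" using X degree by auto
  ultimately show ?thesis by (rule finite_subset)
qed

lemma occurs_finite:
  assumes "occurs B \<omega>"
  shows "finite B" "B \<subseteq> V" "B \<noteq> {}"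
proof -
  obtain X where X: "interface X \<omega>" "B = snd ` outward X" using assms by (auto simp: occurs_def)
  show "finite B" using X finite_outward by (auto simp: interface_def)
  show "B \<subseteq> V" using X(2) E_subset by (auto simp: outward_def)
  obtain e where "outward X = link_class \<omega> e" using X(1) by (auto simp: interface_def)
  then have "snd e \<in> B" using X(2) link_class_refl by simp
  then show "B \<noteq> {}" by auto
qed

text \<open>A walk through the link class moves the head by at most \<open>m\<close> at each step
  and stays among the heads of the interface.\<close>

lemma occurs_connected:
  assumes "occurs B \<omega>" "b \<in> B" "b' \<in> B"
  shows "(b, b') \<in> (Restr (near m) B)\<^sup>*"
proof -
  obtain X where X: "interface X \<omega>" "B = snd ` outward X" using assms by (auto simp: occurs_def)
  obtain e e' where e: "e \<in> outward X" "b = snd e" "e' \<in> outward X" "b' = snd e'"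
    using assms X(2) by auto
  have cls: "outward X = link_class \<omega> e"
    using X(1) e(1) link_class_eq unfolding interface_def by metis
  have "e' \<in> link_class \<omega> e" using e(3) cls by simp
  then have "(snd e, snd e') \<in> (Restr (near m) B)\<^sup>*"
  proof (induction rule: link_class_induct)
    case (step f f')
    have "f' \<in> outward X" "f \<in> outward X" using step link_class_step cls by auto
    moreover have "(snd f, snd f') \<in> near m" using step.hyps linked_heads near_sym by blast
    ultimately have "(snd f, snd f') \<in> Restr (near m) B" using X(2) by auto
    then show ?case using step.IH by (rule rtrancl_into_rtrancl[rotated])
  qed simp
  then show ?thesis using e by simp
qed

text \<open>A path in an n-set needs at most as many hops as the relation has pairs, at most n * n,
  and each hop has length at most \<open>m\<close>. Only polynomial growth matters.\<close>

definition diam_bound :: "nat \<Rightarrow> nat" where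
  "diam_bound n = m * (n * n)"

lemma occurs_diameter:
  assumes "occurs B \<omega>" "b \<in> B" "b' \<in> B"
  shows "(b, b') \<in> near (diam_bound (card B))"
proof -
  let ?r = "Restr (near m) B"
  have B: "finite B" using occurs_finite assms by blast
  then have fin: "finite ?r" by auto
  obtain k where k: "k \<le> card ?r" "(b, b') \<in> ?r ^^ k"
    using occurs_connected[OF assms] unfolding rtrancl_finite_eq_relpow[OF fin] by auto
  have "(b, b') \<in> near (m * k)" using relpow_relpow[OF relpow_Restr[OF k(2)]] .
  moreover have "card ?r \<le> card (B \<times> B)" using B by (intro card_mono) auto
  then have "m * k \<le> diam_bound (card B)"
    using k(1) unfolding diam_bound_def by (simp add: card_cartesian_product)
  ultimately show ?thesis by (rule near_mono)
qed

section \<open>Geodesics crossing interfaces\<close>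

text \<open>A geodesic segment of length \<open>2 * l\<close>, thought of as centred at
  \<open>g l\<close>, so that both halves have length \<open>l\<close>.\<close>

definition is_geodesic :: "(nat \<Rightarrow> 'v) \<Rightarrow> nat \<Rightarrow> bool" where
  "is_geodesic g l \<longleftrightarrow> (\<forall>i<2 * l. (g i, g (Suc i)) \<in> E) \<and>
      (\<forall>i j k. i \<le> j \<and> j \<le> 2 * l \<and> (g i, g j) \<in> near k \<longrightarrow> j - i \<le> k)"

lemma obtain_geodesic:
  assumes "x \<in> V"
  obtains g where "g l = x" "is_geodesic g l"
proof -
  obtain g where "g l = x \<and> (\<forall>i<2 * l. (g i, g (Suc i)) \<in> E) \<and>
      (\<forall>i j k. i \<le> j \<and> j \<le> 2 * l \<and> (g i, g j) \<in> near k \<longrightarrow> j - i \<le> k)"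
    using geodesic[OF assms, of l] by (rule exE)
  then show ?thesis using that[of g] by (simp add: is_geodesic_def)
qed

lemma geodesic_dist:
  "is_geodesic g l \<Longrightarrow> i \<le> j \<Longrightarrow> j \<le> 2 * l \<Longrightarrow> (g i, g j) \<in> near k \<Longrightarrow> j - i \<le> k"
  by (simp add: is_geodesic_def)

lemma geodesic_end_dist:
  assumes "is_geodesic g l" "i = 0 \<or> i = 2 * l" "(g l, g i) \<in> near k"
  shows "l \<le> k"
  using geodesic_dist[OF assms(1), of l i k] geodesic_dist[OF assms(1), of i l k] near_sym[OF assms(3)] assms(2,3)
  by auto

lemma geodesic_near:
  assumes g: "is_geodesic g l" and "i \<le> j" "j \<le> 2 * l"
  shows "(g i, g j) \<in> near (j - i)"
  using assms(2,3)
proof (induction j rule: dec_induct)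
  case (step j)
  then have "(g i, g j) \<in> near (j - i)" "(g j, g (Suc j)) \<in> E"
    using g by (auto simp: is_geodesic_def)
  then have "(g i, g (Suc j)) \<in> near (Suc (j - i))" by auto
  then show ?case using step by (simp add: Suc_diff_le)
qed simp

text \<open>Both halves of a geodesic through the inside of an interface have to cross it, and the two
  crossings are at most the diameter of the interface apart.\<close>

lemma geodesic_hits:
  assumes X: "interface X \<omega>" and g: "is_geodesic g l" and ends: "g l \<in> X" "g 0 \<notin> X" "g (2 * l) \<notin> X"
  defines "B \<equiv> snd ` outward X"
  obtains i where "i \<le> diam_bound (card B)" "l + i \<le> 2 * l" "g (l + i) \<in> B"
proof -
  have occ: "occurs B \<omega>" using X by (auto simp: occurs_def B_def)
  obtain i where i: "l \<le> i" "i < 2 * l" "g i \<in> X" "g (Suc i) \<notin> X"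
    using exists_last_step[of "\<lambda>i. g i \<in> X" l "2 * l"] ends by auto
  obtain j where j: "j < l" "g j \<notin> X" "g (Suc j) \<in> X"
    using exists_last_step[of "\<lambda>i. g i \<notin> X" 0 l] ends by auto
  have E: "(g i, g (Suc i)) \<in> E" "(g (Suc j), g j) \<in> E"
    using g i j E_sym by (auto simp: is_geodesic_def)
  have "(g i, g (Suc i)) \<in> outward X" "(g (Suc j), g j) \<in> outward X"
    using E i j by (auto simp: outward_def)
  then have B: "g (Suc i) \<in> B" "g j \<in> B" unfolding B_def by force+
  have "Suc i - j \<le> diam_bound (card B)"
    by (rule geodesic_dist[OF g _ _ occurs_diameter[OF occ B(2,1)]]) (use i j in auto)
  then show ?thesis using that[of "Suc i - l"] B(1) i j by auto
qed

text \<open>A geodesic centred at \<open>z\<close> that is long enough for both ends to lie outside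
  \<open>X\<close> crosses the interface on both sides, hence meets it close to
  \<open>z\<close>.\<close>

lemma interface_near_heads:
  assumes X: "interface X \<omega>" and z: "z \<in> X"
  defines "B \<equiv> snd ` outward X"
  obtains b where "b \<in> B" "(z, b) \<in> near (diam_bound (card B))"
proof -
  have fX: "finite X" "X \<subseteq> V" using X by (auto simp: interface_def)
  have "\<exists>k. (z, x) \<in> near k" if "x \<in> X" for x
  proof -
    have "(z, x) \<in> E\<^sup>*" using connected z that fX by auto
    then have "(z, x) \<in> (E\<^sup>=)\<^sup>*" by simp
    then show ?thesis by (rule rtrancl_imp_relpow)
  qed
  then obtain k where k: "\<And>x. x \<in> X \<Longrightarrow> (z, x) \<in> near (k x)" by metis
  \<comment> \<open>\<open>l\<close> exceeds the distance from \<open>z\<close> to every point of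
    \<open>X\<close>, so the ends at distance \<open>l\<close> are outside.\<close>
  define l where "l = Suc (Max (k ` X))"
  have kl: "k x < l" if "x \<in> X" for x using that fX(1) by (simp add: l_def less_Suc_eq_le)
  have "z \<in> V" using z fX by auto
  then obtain g where g: "g l = z" "is_geodesic g l" by (rule obtain_geodesic)
  have out: "g i \<notin> X" if "i = 0 \<or> i = 2 * l" for i
  proof
    assume "g i \<in> X"
    then have "(g l, g i) \<in> near (k (g i))" "k (g i) < l" using k kl g(1) by auto
    then show False using geodesic_end_dist[OF g(2) that] by fastforce
  qed
  obtain i where i: "i \<le> diam_bound (card B)" "l + i \<le> 2 * l" "g (l + i) \<in> B"
    unfolding B_def by (rule geodesic_hits[OF X g(2)]) (use g(1) z out in auto)
  have "(g l, g (l + i)) \<in> near i" using geodesic_near[OF g(2), of l "l + i"] i by simp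
  then have "(z, g (l + i)) \<in> near (diam_bound (card B))" using near_mono i(1) g(1) by simp
  then show ?thesis using that i(3) by simp
qed

text \<open>For counting, the geodesic must depend on \<open>n\<close> only. Going from
  \<open>v0\<close> to a head, across the interface and from a head to any inside point costs at
  most three diameters, so half-length 3 diameters + 1 puts both ends outside every interface with
  \<open>n\<close> vacant vertices.\<close>

lemma occurs_hits_fixed_geodesic:
  assumes g: "is_geodesic g l" "g l = v0" and l: "l = Suc (3 * diam_bound n)"
    and B: "occurs B \<omega>" "card B = n"
  obtains i where "i \<le> diam_bound n" "g (l + i) \<in> B"
proof -
  let ?f = "diam_bound n"
  obtain X where X: "interface X \<omega>" "B = snd ` outward X" using B by (auto simp: occurs_def)
  have v0X: "v0 \<in> X" using X by (auto simp: interface_def)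
  have near3: "(v0, x) \<in> near (3 * ?f)" if x: "x \<in> X" for x
  proof -
    obtain b where b: "b \<in> B" "(v0, b) \<in> near ?f"
      using interface_near_heads[OF X(1) v0X] X(2) B(2) by auto
    obtain b' where b': "b' \<in> B" "(x, b') \<in> near ?f"
      using interface_near_heads[OF X(1) x] X(2) B(2) by auto
    have bb': "(b, b') \<in> near ?f" using occurs_diameter[OF B(1) b(1) b'(1)] B(2) by simp
    have "(v0, x) \<in> near (?f + (?f + ?f))"
      by (rule relpow_trans[OF b(2) relpow_trans[OF bb' near_sym[OF b'(2)]]])
    moreover have "?f + (?f + ?f) = 3 * ?f" by simp
    ultimately show ?thesis by (simp only:)
  qed
  have out: "g i \<notin> X" if "i = 0 \<or> i = 2 * l" for i
  proof
    assume "g i \<in> X"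
    then have *: "(g l, g i) \<in> near (3 * ?f)" using near3 g(2) by auto
    have "l \<le> 3 * ?f" by (rule geodesic_end_dist[OF g(1) that *])
    then show False using l by simp
  qed
  obtain i where "i \<le> diam_bound (card B)" "g (l + i) \<in> B"
    unfolding X(2) by (rule geodesic_hits[OF X(1) g(1)]) (use g(2) v0X out in auto)
  then show ?thesis using that B(2) by auto
qed

section \<open>Counting interfaces and analyticity\<close>

lemma two_le_power_degree: "2 \<le> d ^ m"
  using self_le_power[of d m] d m by linarith

text \<open>A vacant set is an animal of \<open>near m\<close> rooted at one of m n^2 + 1
  consecutive vertices of a fixed geodesic.\<close>

lemma card_occurs_le:
  shows "finite {B \<in> {B. \<exists>\<omega>. occurs B \<omega>}. card B = n}" (is "finite ?S")
    and "real (card {B \<in> {B. \<exists>\<omega>. occurs B \<omega>}. card B = n}) \<le>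
      real (m * (n * n) + 1) * (4 * ((real (d ^ m) - 1) * exp 1) ^ n)"
proof -
  define l where "l = Suc (3 * diam_bound n)"
  obtain g where g: "g l = v0" "is_geodesic g l" using v0 by (rule obtain_geodesic)
  let ?A = "\<lambda>i. animals (near m) V (g (l + i)) n"
  have deg: "finite (near m `` {x}) \<and> card (near m `` {x} - {x}) \<le> d ^ m" if "x \<in> V" for x
    using finite_near card_near_le m that by blast
  have sym: "Relation.sym (near m)" by (rule symI) (rule near_sym)
  note bound = card_animals_le[OF sym two_le_power_degree deg]
  have sub: "?S \<subseteq> (\<Union>i\<le>diam_bound n. ?A i)"
  proof
    fix B assume "B \<in> ?S"
    then obtain \<omega> where B: "occurs B \<omega>" "card B = n" by auto
    obtain i where i: "i \<le> diam_bound n" "g (l + i) \<in> B"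
      by (rule occurs_hits_fixed_geodesic[OF g(2,1) l_def B])
    have "B \<in> ?A i"
      using occurs_finite[OF B(1)] B(2) i(2) occurs_connected[OF B(1) i(2)] by (simp add: animals_def)
    then show "B \<in> (\<Union>i\<le>diam_bound n. ?A i)" using i(1) by blast
  qed
  have fin: "finite (\<Union>i\<le>diam_bound n. ?A i)" using bound(1) by blast
  show "finite ?S" by (rule finite_subset[OF sub fin])
  have "card ?S \<le> card (\<Union>i\<le>diam_bound n. ?A i)" by (rule card_mono[OF fin sub])
  also have "\<dots> \<le> (\<Sum>i\<le>diam_bound n. card (?A i))" by (rule card_UN_le) simp
  finally have "real (card ?S) \<le> real (\<Sum>i\<le>diam_bound n. card (?A i))"
    by (simp only: of_nat_le_iff)
  also have "\<dots> = (\<Sum>i\<le>diam_bound n. real (card (?A i)))" by (rule of_nat_sum)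
  also have "\<dots> \<le> (\<Sum>i\<le>diam_bound n. 4 * ((real (d ^ m) - 1) * exp 1) ^ n)"
    by (intro sum_mono bound(2))
  also have "\<dots> = real (m * (n * n) + 1) * (4 * ((real (d ^ m) - 1) * exp 1) ^ n)"
    by (simp add: diam_bound_def)
  finally show "real (card ?S) \<le> real (m * (n * n) + 1) * (4 * ((real (d ^ m) - 1) * exp 1) ^ n)" .
qed

theorem real_analytic_on_percolation:
  defines "\<gamma> \<equiv> (real (d ^ m) - 1) * exp 1"
  assumes \<theta>: "\<And>p. \<theta> p = measure (Pi\<^sub>M V (\<lambda>_. measure_pmf (bernoulli_pmf p)))
       {\<omega> \<in> space (Pi\<^sub>M V (\<lambda>_. measure_pmf (bernoulli_pmf p))).
         v0 \<in> {x \<in> V. \<omega> x} \<and> infinite ((Restr E {x \<in> V. \<omega> x})\<^sup>* `` {v0})}"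
  shows "1 \<le> \<gamma>" and "real_analytic_on \<theta> {1 - 1 / \<gamma><..1}"
proof -
  let ?\<B> = "{B. \<exists>\<omega>. occurs B \<omega>}"
  have "real 2 \<le> real (d ^ m)" using two_le_power_degree by (simp only: of_nat_le_iff)
  then have "1 * 1 \<le> \<gamma>" unfolding \<gamma>_def by (intro mult_mono) auto
  then show \<gamma>1: "1 \<le> \<gamma>" by simp
  \<comment> \<open>A ball of radius \<open>m\<close> has at most d^m + 1 vertices, the 1 being its
    centre.\<close>
  interpret polymer_system V v0 ?\<B> occurs nbhd "d ^ m + 1"
  proof
    show "v0 \<in> V" by (rule v0)
    show "finite (nbhd B) \<and> B \<subseteq> nbhd B \<and> nbhd B \<subseteq> V" if "B \<in> ?\<B>" for B
    proof -
      have B: "finite B" "B \<subseteq> V" using that occurs_finite by blast+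
      have eq: "nbhd B = (\<Union>b\<in>B. near m `` {b})" by (auto simp: nbhd_def)
      have "(b, b) \<in> near m" for b using near_mono[of b b 0 m] by simp
      then have "B \<subseteq> nbhd B" by (auto simp: nbhd_def)
      moreover have "nbhd B \<subseteq> V" unfolding nbhd_def using near_in_V B by blast
      moreover have "finite (nbhd B)" unfolding eq using B finite_near by auto
      ultimately show ?thesis by simp
    qed
    show "card (nbhd B) \<le> (d ^ m + 1) * card B" if "B \<in> ?\<B>" for B
    proof -
      have B: "finite B" "B \<subseteq> V" using that occurs_finite by blast+
      have eq: "nbhd B = (\<Union>b\<in>B. near m `` {b})" by (auto simp: nbhd_def)
      have "card (nbhd B) \<le> (\<Sum>b\<in>B. card (near m `` {b}))"
        unfolding eq by (rule card_UN_le[OF B(1)])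
      also have "\<dots> \<le> (\<Sum>b\<in>B. d ^ m + 1)"
      proof (rule sum_mono)
        fix b assume "b \<in> B"
        then have b: "b \<in> V" using B by auto
        have "card (near m `` {b}) \<le> card (insert b (near m `` {b} - {b}))"
          using finite_near[OF b] by (intro card_mono) auto
        also have "\<dots> \<le> Suc (card (near m `` {b} - {b}))" by (rule card_insert_le_m1) auto
        finally show "card (near m `` {b}) \<le> d ^ m + 1" using card_near_le[OF b m] by simp
      qed
      finally show ?thesis by (simp add: mult.commute)
    qed
    show "occurs B Y \<longleftrightarrow> occurs B (Y \<inter> nbhd B)" for B Y using occurs_local by simp
    show "Y \<inter> B = {}" if "occurs B Y" for B Y by (rule occurs_vacant[OF that])
    show "B \<inter> B' = {}" if "occurs B Y" "occurs B' Y" "B \<noteq> B'" for B B' Y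
      by (rule occurs_disjoint[OF that])
    show "finite {B \<in> ?\<B>. card B = n}" for n by (rule card_occurs_le(1))
  qed
  show "real_analytic_on \<theta> {1 - 1 / \<gamma><..1}"
  proof (rule real_analytic_on_avoidance[OF \<gamma>1])
    fix r :: real assume r: "0 \<le> r" "r < 1 / \<gamma>"
    then have x: "0 \<le> \<gamma> * r" "\<gamma> * r < 1" using \<gamma>1 by (auto simp: field_simps)
    have "summable (\<lambda>n. 4 * (real (m * (n * n) + 1) * (\<gamma> * r) ^ n))"
      by (intro summable_mult summable_quadratic_geometric x)
    then show "summable (\<lambda>n. real (card {B \<in> ?\<B>. card B = n}) * r ^ n)"
    proof (rule summable_comparison_test')
      fix n :: nat
      have "real (card {B \<in> ?\<B>. card B = n}) * r ^ n \<le> real (m * (n * n) + 1) * (4 * \<gamma> ^ n) * r ^ n"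
        unfolding \<gamma>_def using r by (intro mult_right_mono card_occurs_le(2)) auto
      then show "norm (real (card {B \<in> ?\<B>. card B = n}) * r ^ n) \<le> 4 * (real (m * (n * n) + 1) * (\<gamma> * r) ^ n)"
        using r by (simp add: power_mult_distrib mult_ac)
    qed
  next
    fix p :: real
    have "v0 \<in> W \<and> infinite ((Restr E W)\<^sup>* `` {v0}) \<longleftrightarrow> v0 \<in> W \<and> (\<forall>B\<in>?\<B>. \<not> occurs B W)" for W
      using finite_cluster_iff_occurs by auto
    then show "\<theta> p = measure (Pi\<^sub>M V (\<lambda>_. measure_pmf (bernoulli_pmf p)))
       {\<omega> \<in> space (Pi\<^sub>M V (\<lambda>_. measure_pmf (bernoulli_pmf p))).
         v0 \<in> {x \<in> V. \<omega> x} \<and> (\<forall>B\<in>?\<B>. \<not> occurs B {x \<in> V. \<omega> x})}"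
      unfolding \<theta> by (simp only:)
  qed
qed

end

section \<open>Cayley graphs of finite presentations\<close>

locale finite_presentation =
  fixes S :: "'a set" and R :: "'a word set"
  assumes finite_S: "finite S" and finite_R: "finite R" and R_words: "R \<subseteq> words S"
begin

section \<open>Words acting on the group from the right\<close>

abbreviation P :: "'a word set monoid" where "P \<equiv> presented_group S R"
abbreviation V :: "'a word set set" where "V \<equiv> carrier P"
abbreviation cls :: "'a word \<Rightarrow> 'a word set" where "cls \<equiv> word_class S R"
abbreviation E :: "('a word set \<times> 'a word set) set" where "E \<equiv> arcs (presentation_graph S R)"
abbreviation G where "G \<equiv> presentation_graph S R"

sublocale group P by (rule group_presented_group)

lemma verts_G: "verts G = V"
  by (simp add: presentation_graph_def cayley_graph_def)

lemma one_eq: "\<one>\<^bsub>P\<^esub> = cls []"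
  by (simp add: presented_group_def)

lemma cls_closed [simp]: "w \<in> words S \<Longrightarrow> cls w \<in> V"
  unfolding carrier_presented_group by blast

lemma V_rep: "x \<in> V \<Longrightarrow> \<exists>w\<in>words S. x = cls w"
  unfolding carrier_presented_group by blast

lemma cls_append: "u \<in> words S \<Longrightarrow> v \<in> words S \<Longrightarrow> cls (u @ v) = cls u \<otimes>\<^bsub>P\<^esub> cls v"
  by (simp add: mult_presented_group)

lemma act_append:
  "g \<in> V \<Longrightarrow> u \<in> words S \<Longrightarrow> v \<in> words S \<Longrightarrow> g \<otimes>\<^bsub>P\<^esub> cls (u @ v) = g \<otimes>\<^bsub>P\<^esub> cls u \<otimes>\<^bsub>P\<^esub> cls v"
  by (simp add: cls_append m_assoc)

lemma act_Nil: "g \<in> V \<Longrightarrow> g \<otimes>\<^bsub>P\<^esub> cls [] = g"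
  by (simp flip: one_eq)

lemma letter_words [simp]: "[l] \<in> words S \<longleftrightarrow> fst l \<in> S"
  by (cases l) (auto simp: words_def)

lemma Cons_words: "l # w \<in> words S \<longleftrightarrow> fst l \<in> S \<and> w \<in> words S"
  by (cases l) (auto simp: words_def)

lemma words_take [simp]: "w \<in> words S \<Longrightarrow> take i w \<in> words S"
  and words_drop [simp]: "w \<in> words S \<Longrightarrow> drop i w \<in> words S"
  unfolding words_def by (auto dest: in_set_takeD in_set_dropD)

lemma letter_cancel:
  assumes "s \<in> S"
  shows "cls [(s, b)] \<otimes>\<^bsub>P\<^esub> cls [(s, \<not> b)] = \<one>\<^bsub>P\<^esub>"
proof -
  have "([] @ [(s, b), (s, \<not> b)] @ [], [] @ []) \<in> word_cong S R"
    using assms by (intro word_cong.cancel) auto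
  then have "cls ([(s, b)] @ [(s, \<not> b)]) = cls []"
    using assms by (subst word_class_eq_iff) (auto simp: Cons_words)
  then show ?thesis using assms by (simp only: cls_append letter_words fst_conv one_eq)
qed

lemma relator_one: "r \<in> R \<Longrightarrow> cls r = \<one>\<^bsub>P\<^esub>"
  using word_cong.relator[of "[]" S "[]" r R] R_words
  by (auto simp: one_eq word_class_eq_iff subset_iff)

text \<open>The two orientations in the definition of an edge merge into one step by a letter, since
  stepping back along a generator is stepping along its formal inverse.\<close>

lemma E_iff: "(g, h) \<in> E \<longleftrightarrow> g \<in> V \<and> h \<in> V \<and> g \<noteq> h \<and> (\<exists>l. fst l \<in> S \<and> h = g \<otimes>\<^bsub>P\<^esub> cls [l])"
proof -
  have move: "g = h \<otimes>\<^bsub>P\<^esub> cls [(s, b)] \<longleftrightarrow> h = g \<otimes>\<^bsub>P\<^esub> cls [(s, \<not> b)]"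
    if "g \<in> V" "h \<in> V" "s \<in> S" for g h s b
  proof -
    have "cls [(s, b)] \<otimes>\<^bsub>P\<^esub> cls [(s, \<not> b)] = \<one>\<^bsub>P\<^esub>" "cls [(s, \<not> b)] \<otimes>\<^bsub>P\<^esub> cls [(s, b)] = \<one>\<^bsub>P\<^esub>"
      using letter_cancel[OF that(3), of b] letter_cancel[OF that(3), of "\<not> b"] by simp_all
    then show ?thesis using that by (auto simp: m_assoc)
  qed
  have "(g, h) \<in> E \<longleftrightarrow> g \<in> V \<and> h \<in> V \<and> g \<noteq> h \<and>
      (\<exists>s\<in>S. h = g \<otimes>\<^bsub>P\<^esub> cls [(s, True)] \<or> g = h \<otimes>\<^bsub>P\<^esub> cls [(s, True)])"
    by (auto simp: presentation_graph_def cayley_graph_def generators_def)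
  also have "\<dots> \<longleftrightarrow> g \<in> V \<and> h \<in> V \<and> g \<noteq> h \<and>
      (\<exists>s\<in>S. h = g \<otimes>\<^bsub>P\<^esub> cls [(s, True)] \<or> h = g \<otimes>\<^bsub>P\<^esub> cls [(s, False)])"
    using move[of g h _ True] by auto
  also have "\<dots> \<longleftrightarrow> g \<in> V \<and> h \<in> V \<and> g \<noteq> h \<and> (\<exists>l. fst l \<in> S \<and> h = g \<otimes>\<^bsub>P\<^esub> cls [l])"
    by (metis (full_types) fst_conv prod.collapse)
  finally show ?thesis .
qed

lemma E_I: "g \<in> V \<Longrightarrow> fst l \<in> S \<Longrightarrow> g \<otimes>\<^bsub>P\<^esub> cls [l] \<noteq> g \<Longrightarrow> (g, g \<otimes>\<^bsub>P\<^esub> cls [l]) \<in> E"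
  unfolding E_iff by (metis cls_closed letter_words m_closed)

lemma E_E:
  assumes "(g, h) \<in> E"
  obtains l where "g \<in> V" "fst l \<in> S" "h = g \<otimes>\<^bsub>P\<^esub> cls [l]" "h \<noteq> g"
  using assms unfolding E_iff by metis

lemma E_sym: "(g, h) \<in> E \<Longrightarrow> (h, g) \<in> E"
  by (auto simp: presentation_graph_def cayley_graph_def)

lemma E_subset: "E \<subseteq> V \<times> V"
  using E_iff by auto

section \<open>Translations, word metric and geodesics\<close>

text \<open>Edges come from right multiplication, so left multiplication is an automorphism.\<close>

lemma E_translate:
  assumes "k \<in> V" "(g, h) \<in> E"
  shows "(k \<otimes>\<^bsub>P\<^esub> g, k \<otimes>\<^bsub>P\<^esub> h) \<in> E"
proof -
  obtain l where l: "g \<in> V" "fst l \<in> S" "h = g \<otimes>\<^bsub>P\<^esub> cls [l]" "h \<noteq> g"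
    using assms(2) by (rule E_E)
  then have "k \<otimes>\<^bsub>P\<^esub> h = k \<otimes>\<^bsub>P\<^esub> g \<otimes>\<^bsub>P\<^esub> cls [l]" using assms(1) by (simp add: m_assoc)
  moreover have "k \<otimes>\<^bsub>P\<^esub> h \<noteq> k \<otimes>\<^bsub>P\<^esub> g" using l assms(1) by simp
  ultimately show ?thesis using E_I[of "k \<otimes>\<^bsub>P\<^esub> g" l] l assms(1) by simp
qed

text \<open>A letter may represent the identity, and the walk then stays where it is.\<close>

lemma step_reflcl:
  "g \<in> V \<Longrightarrow> fst l \<in> S \<Longrightarrow> (g, g \<otimes>\<^bsub>P\<^esub> cls [l]) \<in> E\<^sup>="
  using E_I[of g l] by (cases "g \<otimes>\<^bsub>P\<^esub> cls [l] = g") simp_all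

lemma word_near:
  "w \<in> words S \<Longrightarrow> g \<in> V \<Longrightarrow> (g, g \<otimes>\<^bsub>P\<^esub> cls w) \<in> (E\<^sup>=) ^^ length w"
proof (induction w arbitrary: g)
  case (Cons l w)
  then have w: "fst l \<in> S" "w \<in> words S" by (auto simp: Cons_words)
  let ?g = "g \<otimes>\<^bsub>P\<^esub> cls [l]"
  have "(g, ?g) \<in> E\<^sup>=" using Cons.prems w by (intro step_reflcl)
  moreover have "(?g, ?g \<otimes>\<^bsub>P\<^esub> cls w) \<in> (E\<^sup>=) ^^ length w"
    using Cons.IH[OF w(2), of ?g] Cons.prems w by simp
  moreover have "?g \<otimes>\<^bsub>P\<^esub> cls w = g \<otimes>\<^bsub>P\<^esub> cls (l # w)"
    using act_append[of g "[l]" w] Cons.prems w by simp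
  ultimately show ?case by (simp only: list.size(4) add_Suc_right add_0_right) (metis relpow_Suc_I2)
qed (simp add: act_Nil)

lemma near_word:
  assumes "(g, h) \<in> (E\<^sup>=) ^^ k" "g \<in> V"
  shows "\<exists>w\<in>words S. length w \<le> k \<and> h = g \<otimes>\<^bsub>P\<^esub> cls w"
  using assms(1)
proof (induction k arbitrary: h)
  case 0
  then show ?case using assms(2) by (intro bexI[of _ "[]"]) (auto simp: act_Nil)
next
  case (Suc k)
  then obtain h' where h': "(g, h') \<in> (E\<^sup>=) ^^ k" "(h', h) \<in> E\<^sup>=" by auto
  obtain w where w: "w \<in> words S" "length w \<le> k" "h' = g \<otimes>\<^bsub>P\<^esub> cls w" using Suc.IH[OF h'(1)] by blast
  show ?case
  proof (cases "h' = h")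
    case False
    then have "(h', h) \<in> E" using h'(2) by simp
    then obtain l where "fst l \<in> S" "h = h' \<otimes>\<^bsub>P\<^esub> cls [l]" by (rule E_E)
    then show ?thesis using w assms(2) act_append[of g w "[l]"]
      by (intro bexI[of _ "w @ [l]"]) auto
  next
    case True
    then show ?thesis using w by (intro bexI[of _ w]) auto
  qed
qed

lemma E_connected:
  assumes "x \<in> V" "y \<in> V"
  shows "(x, y) \<in> E\<^sup>*"
proof -
  obtain w where w: "w \<in> words S" "inv\<^bsub>P\<^esub> x \<otimes>\<^bsub>P\<^esub> y = cls w"
    using V_rep[of "inv\<^bsub>P\<^esub> x \<otimes>\<^bsub>P\<^esub> y"] assms by auto
  have "x \<otimes>\<^bsub>P\<^esub> cls w = y" using assms by (simp flip: w(2) m_assoc)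
  then have "(x, y) \<in> (E\<^sup>=)\<^sup>*" using word_near[OF w(1) assms(1)] relpow_imp_rtrancl by metis
  then show ?thesis by simp
qed

lemma degree_eq:
  assumes "x \<in> V"
  shows "finite (E `` {x})" "card (E `` {x}) = cayley_degree S R"
proof -
  have fin: "finite (E `` {\<one>\<^bsub>P\<^esub>})"
  proof (rule finite_subset)
    show "E `` {\<one>\<^bsub>P\<^esub>} \<subseteq> (\<lambda>l. cls [l]) ` (S \<times> UNIV)"
    proof
      fix y assume "y \<in> E `` {\<one>\<^bsub>P\<^esub>}"
      then have "(\<one>\<^bsub>P\<^esub>, y) \<in> E" by simp
      then obtain l where l: "fst l \<in> S" "y = \<one>\<^bsub>P\<^esub> \<otimes>\<^bsub>P\<^esub> cls [l]" by (rule E_E)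
      then have "y = cls [l]" by simp
      moreover have "l \<in> S \<times> UNIV" using l(1) by (simp add: mem_Times_iff)
      ultimately show "y \<in> (\<lambda>l. cls [l]) ` (S \<times> UNIV)" by (rule image_eqI)
    qed
  qed (use finite_S in auto)
  have img: "E `` {x} = (\<lambda>y. x \<otimes>\<^bsub>P\<^esub> y) ` (E `` {\<one>\<^bsub>P\<^esub>})"
  proof (intro equalityI subsetI)
    fix y assume "y \<in> E `` {x}"
    then have "(x, y) \<in> E" by auto
    then have y: "y \<in> V" and "(inv\<^bsub>P\<^esub> x \<otimes>\<^bsub>P\<^esub> x, inv\<^bsub>P\<^esub> x \<otimes>\<^bsub>P\<^esub> y) \<in> E"
      using E_subset E_translate[of "inv\<^bsub>P\<^esub> x" x y] assms by auto
    then have "inv\<^bsub>P\<^esub> x \<otimes>\<^bsub>P\<^esub> y \<in> E `` {\<one>\<^bsub>P\<^esub>}" using assms by simp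
    moreover have "y = x \<otimes>\<^bsub>P\<^esub> (inv\<^bsub>P\<^esub> x \<otimes>\<^bsub>P\<^esub> y)" using assms y by (simp flip: m_assoc)
    ultimately show "y \<in> (\<lambda>y. x \<otimes>\<^bsub>P\<^esub> y) ` (E `` {\<one>\<^bsub>P\<^esub>})" by blast
  next
    fix y assume "y \<in> (\<lambda>y. x \<otimes>\<^bsub>P\<^esub> y) ` (E `` {\<one>\<^bsub>P\<^esub>})"
    then obtain u where "(\<one>\<^bsub>P\<^esub>, u) \<in> E" "y = x \<otimes>\<^bsub>P\<^esub> u" by auto
    then show "y \<in> E `` {x}" using E_translate[OF assms, of "\<one>\<^bsub>P\<^esub>" u] assms by simp
  qed
  have inj: "inj_on (\<lambda>y. x \<otimes>\<^bsub>P\<^esub> y) (E `` {\<one>\<^bsub>P\<^esub>})"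
  proof (rule inj_onI)
    fix y y' assume "y \<in> E `` {\<one>\<^bsub>P\<^esub>}" "y' \<in> E `` {\<one>\<^bsub>P\<^esub>}" and eq: "x \<otimes>\<^bsub>P\<^esub> y = x \<otimes>\<^bsub>P\<^esub> y'"
    then have "y \<in> V" "y' \<in> V" using E_subset by auto
    then show "y = y'" using eq assms by simp
  qed
  have tail: "tail G = fst" by (simp add: presentation_graph_def cayley_graph_def)
  have out: "out_arcs G \<one>\<^bsub>P\<^esub> = Pair \<one>\<^bsub>P\<^esub> ` (E `` {\<one>\<^bsub>P\<^esub>})"
  proof (intro equalityI subsetI)
    fix e assume "e \<in> out_arcs G \<one>\<^bsub>P\<^esub>"
    then have "e \<in> E" "fst e = \<one>\<^bsub>P\<^esub>" by (simp_all only: out_arcs_def tail mem_Collect_eq)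
    then show "e \<in> Pair \<one>\<^bsub>P\<^esub> ` (E `` {\<one>\<^bsub>P\<^esub>})"
      by (intro image_eqI[of _ _ "snd e"]) (simp_all only: Image_singleton_iff prod.collapse flip: \<open>fst e = _\<close>)
  next
    fix e assume "e \<in> Pair \<one>\<^bsub>P\<^esub> ` (E `` {\<one>\<^bsub>P\<^esub>})"
    then show "e \<in> out_arcs G \<one>\<^bsub>P\<^esub>"
      by (elim imageE) (simp only: out_arcs_def tail mem_Collect_eq Image_singleton_iff fst_conv)
  qed
  have "cayley_degree S R = card (E `` {\<one>\<^bsub>P\<^esub>})"
    unfolding cayley_degree_def out_degree_def out by (rule card_image) (simp add: inj_on_def)
  then show "card (E `` {x}) = cayley_degree S R"
    unfolding img card_image[OF inj] by simp
  show "finite (E `` {x})" unfolding img using fin by simp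
qed

text \<open>An infinite group with finitely many generators has elements of large word length. The
  prefixes of a shortest word for such an element trace a geodesic, which is then
  translated.\<close>

lemma geodesic_exists:
  assumes "infinite V" "x \<in> V"
  shows "\<exists>g. g l = x \<and> (\<forall>i<2 * l. (g i, g (Suc i)) \<in> E) \<and>
      (\<forall>i j k. i \<le> j \<and> j \<le> 2 * l \<and> (g i, g j) \<in> (E\<^sup>=) ^^ k \<longrightarrow> j - i \<le> k)"
proof -
  have "finite (cls ` {w. set w \<subseteq> S \<times> UNIV \<and> length w \<le> 2 * l})"
    using finite_S by (intro finite_imageI finite_lists_length_le) auto
  then obtain y where y: "y \<in> V" "y \<notin> cls ` {w. set w \<subseteq> S \<times> UNIV \<and> length w \<le> 2 * l}"
    using infinite_imp_nonempty[OF Diff_infinite_finite[OF _ assms(1)]] by blast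
  have "\<exists>w. w \<in> words S \<and> y = cls w" using V_rep[OF y(1)] by blast
  then obtain w where w: "w \<in> words S" "y = cls w"
    and w_min: "\<And>w'. w' \<in> words S \<Longrightarrow> y = cls w' \<Longrightarrow> length w \<le> length w'"
    using ex_has_least_nat[of "\<lambda>w. w \<in> words S \<and> y = cls w" _ length] by metis
  have long: "2 * l \<le> length w"
  proof (rule ccontr)
    assume "\<not> 2 * l \<le> length w"
    then have "w \<in> {w. set w \<subseteq> S \<times> UNIV \<and> length w \<le> 2 * l}" using w(1) by (auto simp: words_def)
    then show False using y(2) w(2) by blast
  qed
  \<comment> \<open>The translation that moves the prefix of length \<open>l\<close> to
    \<open>x\<close>.\<close>
  define k where "k = x \<otimes>\<^bsub>P\<^esub> inv\<^bsub>P\<^esub> (cls (take l w))"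
  define g where "g i = k \<otimes>\<^bsub>P\<^esub> cls (take i w)" for i
  have k: "k \<in> V" using assms w by (simp add: k_def)
  have gV: "g i \<in> V" for i using k w by (simp add: g_def)
  have gl: "g l = x" using assms w by (simp add: g_def k_def m_assoc)
  have dist: "j - i \<le> n" if ij: "i \<le> j" "j \<le> 2 * l" "(g i, g j) \<in> (E\<^sup>=) ^^ n" for i j n
  proof -
    obtain u where u: "u \<in> words S" "length u \<le> n" "g j = g i \<otimes>\<^bsub>P\<^esub> cls u"
      using near_word[OF ij(3) gV] by blast
    \<comment> \<open>A shortcut \<open>u\<close> between positions \<open>i\<close> and
      \<open>j\<close> can replace that stretch of \<open>w\<close>, so minimality of
      \<open>w\<close> bounds its length from below.\<close>
    have "k \<otimes>\<^bsub>P\<^esub> cls (take j w) = k \<otimes>\<^bsub>P\<^esub> cls (take i w @ u)"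
      using u(3) k w u(1) by (simp add: g_def act_append)
    then have "cls (take j w) = cls (take i w @ u)" using k w u(1) by simp
    then have "cls (take j w) \<otimes>\<^bsub>P\<^esub> cls (drop j w) = cls (take i w @ u) \<otimes>\<^bsub>P\<^esub> cls (drop j w)" by simp
    then have "y = cls ((take i w @ u) @ drop j w)"
      using w u(1) by (subst cls_append) (auto simp flip: cls_append)
    then have "length w \<le> length ((take i w @ u) @ drop j w)"
      using w u(1) by (intro w_min) auto
    then show ?thesis using ij long u(2) by simp
  qed
  have "(g i, g (Suc i)) \<in> E" if "i < 2 * l" for i
  proof -
    have i: "i < length w" using that long by simp
    have "fst (w ! i) \<in> S" using w(1) i by (auto simp: words_def in_lists_conv_set dest!: nth_mem)
    moreover have "g (Suc i) = g i \<otimes>\<^bsub>P\<^esub> cls [w ! i]"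
      unfolding g_def take_Suc_conv_app_nth[OF i] by (rule act_append) (use k w calculation in auto)
    ultimately have "(g i, g (Suc i)) \<in> E\<^sup>=" using step_reflcl[OF gV] by metis
    moreover have "g i \<noteq> g (Suc i)"
      using dist[of i "Suc i" 0] that by auto
    ultimately show ?thesis by auto
  qed
  then show ?thesis using gl dist by (intro exI[of _ g]) auto
qed

section \<open>Relator cycles\<close>

text \<open>The vertices of the closed walks read off from relators, continued periodically;
  excluding the empty relator makes the period positive.\<close>

definition relator_cycles :: "(nat \<times> (nat \<Rightarrow> 'a word set)) set" where
  "relator_cycles = {(length r, \<lambda>i. g \<otimes>\<^bsub>P\<^esub> cls (take (i mod length r) r)) | g r. g \<in> V \<and> r \<in> R \<and> r \<noteq> []}"

lemma relator_cyclesE: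
  assumes "(L, z) \<in> relator_cycles"
  obtains g r where "g \<in> V" "r \<in> R" "r \<noteq> []" "r \<in> words S" "L = length r"
    "\<And>i. z i = g \<otimes>\<^bsub>P\<^esub> cls (take (i mod length r) r)"
  using assms R_words unfolding relator_cycles_def by auto

lemma relator_cycle_step:
  assumes "g \<in> V" "r \<in> R" "r \<noteq> []"
  shows "g \<otimes>\<^bsub>P\<^esub> cls (take (Suc i mod length r) r) =
    g \<otimes>\<^bsub>P\<^esub> cls (take (i mod length r) r) \<otimes>\<^bsub>P\<^esub> cls [r ! (i mod length r)]" (is ?eq)
    and "fst (r ! (i mod length r)) \<in> S"
proof -
  let ?i = "i mod length r"
  have r: "r \<in> words S" using assms R_words by auto
  have i: "?i < length r" using assms by simp
  show S: "fst (r ! ?i) \<in> S"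
    using r nth_mem[OF i] by (auto simp: words_def in_lists_conv_set)
  have "g \<otimes>\<^bsub>P\<^esub> cls (take (Suc ?i) r) = g \<otimes>\<^bsub>P\<^esub> cls (take ?i r) \<otimes>\<^bsub>P\<^esub> cls [r ! ?i]"
    unfolding take_Suc_conv_app_nth[OF i] using assms r S by (simp add: act_append)
  \<comment> \<open>At the end of the relator the index wraps to 0, which is harmless because
    \<open>cls r\<close> is the identity.\<close>
  moreover have "cls (take (Suc i mod length r) r) = cls (take (Suc ?i) r)"
    using relator_one[OF assms(2)] one_eq by (auto simp: mod_Suc)
  ultimately show ?eq by simp
qed

text \<open>Two points cut the closed walk into pieces of lengths j - i and |r| - (j - i); the
  shorter one has length at most half of |r|, rounded down.\<close>

lemma relator_cycle_near:
  assumes "g \<in> V" "r \<in> R" "i \<le> j" "j \<le> length r"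
  shows "(g \<otimes>\<^bsub>P\<^esub> cls (take i r), g \<otimes>\<^bsub>P\<^esub> cls (take j r)) \<in> (E\<^sup>=) ^^ (length r div 2)"
    and "(g \<otimes>\<^bsub>P\<^esub> cls (take j r), g \<otimes>\<^bsub>P\<^esub> cls (take i r)) \<in> (E\<^sup>=) ^^ (length r div 2)"
proof -
  let ?x = "g \<otimes>\<^bsub>P\<^esub> cls (take i r)" and ?y = "g \<otimes>\<^bsub>P\<^esub> cls (take j r)"
  have r: "r \<in> words S" using assms R_words by auto
  have V: "?x \<in> V" "?y \<in> V" using assms r by auto
  have sym: "Relation.sym ((E\<^sup>=) ^^ k)" for k
    using E_sym by (intro sym_relpow) (auto simp: sym_def)
  have "take j r = take i r @ drop i (take j r)"
    using assms by (metis append_take_drop_id min.absorb1 take_take)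
  then have "?y = ?x \<otimes>\<^bsub>P\<^esub> cls (drop i (take j r))"
    using act_append[of g "take i r" "drop i (take j r)"] assms r by simp
  then have 1: "(?x, ?y) \<in> (E\<^sup>=) ^^ (j - i)"
    using word_near[OF _ V(1), of "drop i (take j r)"] r assms by simp
  have "?y \<otimes>\<^bsub>P\<^esub> cls (drop j r @ take i r) = g \<otimes>\<^bsub>P\<^esub> cls (take j r @ drop j r @ take i r)"
    by (rule act_append[symmetric]) (use assms r in auto)
  also have "\<dots> = g \<otimes>\<^bsub>P\<^esub> cls (r @ take i r)"
    by (simp flip: append_assoc)
  also have "\<dots> = ?x"
    using act_append[of g r "take i r"] assms r relator_one by simp
  finally have 2: "(?y, ?x) \<in> (E\<^sup>=) ^^ (length r - j + i)"
    using word_near[OF _ V(2), of "drop j r @ take i r"] r assms by simp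
  have "(?x, ?y) \<in> (E\<^sup>=) ^^ (length r div 2)"
  proof (cases "j - i \<le> length r div 2")
    case True
    then show ?thesis using 1 relpow_reflcl_mono[OF True] by blast
  next
    case False
    then have "length r - j + i \<le> length r div 2" using assms by linarith
    then show ?thesis using symD[OF sym 2] relpow_reflcl_mono[of _ _ E] by blast
  qed
  then show "(?x, ?y) \<in> (E\<^sup>=) ^^ (length r div 2)" "(?y, ?x) \<in> (E\<^sup>=) ^^ (length r div 2)"
    using symD[OF sym] by auto
qed

lemma length_relator_le:
  assumes "r \<in> R"
  shows "length r \<le> longest_relator_cycle S R"
proof -
  let ?T = "{length (induced_walk S R g r) | g r. g \<in> verts G \<and> r \<in> R}"
  have "?T \<subseteq> length ` R" by (auto simp: induced_walk_def)
  then have "finite ?T" using finite_R finite_subset by blast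
  moreover have "length r \<in> ?T"
    using assms one_closed unfolding verts_G by (auto simp: induced_walk_def intro!: exI[of _ "\<one>\<^bsub>P\<^esub>"])
  ultimately show ?thesis unfolding longest_relator_cycle_def by (rule Max_ge)
qed

section \<open>Crossing parity and cuts\<close>

text \<open>The number modulo 2 of steps marked by \<open>F\<close> on the walk spelled by a word
  from \<open>g\<close>.\<close>

primrec parity :: "('a word set \<Rightarrow> 'a word set \<Rightarrow> bool) \<Rightarrow> 'a word set \<Rightarrow> 'a word \<Rightarrow> bool" where
  "parity F g [] = False"
| "parity F g (l # w) = (F g (g \<otimes>\<^bsub>P\<^esub> cls [l]) \<noteq> parity F (g \<otimes>\<^bsub>P\<^esub> cls [l]) w)"

lemma parity_append:
  "u \<in> words S \<Longrightarrow> v \<in> words S \<Longrightarrow> g \<in> V \<Longrightarrow>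
    parity F g (u @ v) = (parity F g u \<noteq> parity F (g \<otimes>\<^bsub>P\<^esub> cls u) v)"
proof (induction u arbitrary: g)
  case (Cons l u)
  then have u: "fst l \<in> S" "u \<in> words S" by (auto simp: Cons_words)
  have "g \<otimes>\<^bsub>P\<^esub> cls [l] \<otimes>\<^bsub>P\<^esub> cls u = g \<otimes>\<^bsub>P\<^esub> cls (l # u)"
    using act_append[of g "[l]" u] Cons.prems u by simp
  then show ?case using Cons.IH[of "g \<otimes>\<^bsub>P\<^esub> cls [l]"] Cons.prems u by (simp only: append_Cons parity.simps) auto
qed (simp add: act_Nil)

text \<open>A cancelling pair crosses the same step back and forth, and relators have even parity by
  assumption. This is the discrete form of simple connectivity once relators are filled in.\<close>

lemma parity_cong:
  assumes F: "\<And>x y. F x y \<Longrightarrow> F y x"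
    and rel: "\<And>g r. g \<in> V \<Longrightarrow> r \<in> R \<Longrightarrow> \<not> parity F g r"
  shows "(u, v) \<in> word_cong S R \<Longrightarrow> g \<in> V \<Longrightarrow> parity F g u = parity F g v"
proof (induction arbitrary: g rule: word_cong.induct)
  case (cancel u v s b)
  let ?g = "g \<otimes>\<^bsub>P\<^esub> cls u"
  have g: "?g \<in> V" using cancel by simp
  define p where "p = [(s, b), (s, \<not> b)]"
  have p: "p \<in> words S" using cancel by (simp add: Cons_words p_def)
  have return: "?g \<otimes>\<^bsub>P\<^esub> cls [(s, b)] \<otimes>\<^bsub>P\<^esub> cls [(s, \<not> b)] = ?g"
    using g cancel letter_cancel[of s b] by (simp add: m_assoc)
  then have "\<not> parity F ?g p" using F by (auto simp: p_def)
  moreover have "?g \<otimes>\<^bsub>P\<^esub> cls p = ?g"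
    using return act_append[of ?g "[(s, b)]" "[(s, \<not> b)]"] g cancel by (simp add: p_def)
  moreover have "parity F ?g (p @ v) = (parity F ?g p \<noteq> parity F (?g \<otimes>\<^bsub>P\<^esub> cls p) v)"
    by (rule parity_append) (use p g cancel in auto)
  moreover have "parity F g (u @ p @ v) = (parity F g u \<noteq> parity F ?g (p @ v))"
    by (rule parity_append) (use p cancel in auto)
  moreover have "parity F g (u @ v) = (parity F g u \<noteq> parity F ?g v)"
    by (rule parity_append) (use cancel in auto)
  ultimately have "parity F g (u @ p @ v) = parity F g (u @ v)" by simp
  then show ?case unfolding p_def .
next
  case (relator u v r)
  let ?g = "g \<otimes>\<^bsub>P\<^esub> cls u"
  have g: "?g \<in> V" using relator by simp
  have "?g \<otimes>\<^bsub>P\<^esub> cls r = ?g" using relator_one relator g by simp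
  moreover have "\<not> parity F ?g r" using rel g relator by simp
  moreover have "parity F ?g (r @ v) = (parity F ?g r \<noteq> parity F (?g \<otimes>\<^bsub>P\<^esub> cls r) v)"
    by (rule parity_append) (use relator g in auto)
  moreover have "parity F g (u @ r @ v) = (parity F g u \<noteq> parity F ?g (r @ v))"
    by (rule parity_append) (use relator in auto)
  moreover have "parity F g (u @ v) = (parity F g u \<noteq> parity F ?g v)"
    by (rule parity_append) (use relator in auto)
  ultimately show ?case by simp
qed auto

text \<open>Parity from \<open>v0\<close> depends only on the endpoint of the walk; the vertices of
  even parity form the required side.\<close>

lemma cut_exists:
  assumes F: "\<And>x y. F x y \<Longrightarrow> F y x \<and> (x, y) \<in> E"
    and cyc: "\<And>L z. (L, z) \<in> relator_cycles \<Longrightarrow>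
      \<exists>h :: nat \<Rightarrow> bool. (\<forall>i. F (z i) (z (Suc i)) \<longleftrightarrow> h i \<noteq> h (Suc i)) \<and> h L = h 0"
    and v0: "v0 \<in> V"
  shows "\<exists>X\<subseteq>V. v0 \<in> X \<and> (\<forall>(x, y)\<in>E. F x y \<longleftrightarrow> (x \<in> X) \<noteq> (y \<in> X))"
proof -
  have rel: "\<not> parity F g r" if "g \<in> V" "r \<in> R" for g r
  proof (cases "r = []")
    case False
    define z where "z i = g \<otimes>\<^bsub>P\<^esub> cls (take (i mod length r) r)" for i
    have r: "r \<in> words S" using that R_words by auto
    have "(length r, z) \<in> relator_cycles"
      unfolding relator_cycles_def z_def using that False by blast
    then obtain h :: "nat \<Rightarrow> bool" where h: "\<And>i. F (z i) (z (Suc i)) \<longleftrightarrow> h i \<noteq> h (Suc i)" "h (length r) = h 0"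
      using cyc by blast
    \<comment> \<open>The marks telescope along the potential \<open>h\<close>, which returns to its
      initial value after a full turn.\<close>
    have "parity F g (take k r) = (h 0 \<noteq> h k)" if "k \<le> length r" for k
      using that
    proof (induction k)
      case (Suc k)
      have k: "k < length r" "k mod length r = k" using Suc by auto
      note step = relator_cycle_step[OF \<open>g \<in> V\<close> \<open>r \<in> R\<close> False, of k]
      have "take (Suc k) r = take k r @ [r ! k]" by (rule take_Suc_conv_app_nth[OF k(1)])
      moreover have "parity F g (take k r @ [r ! k]) = (parity F g (take k r) \<noteq> F (z k) (z (Suc k)))"
        using parity_append[of "take k r" "[r ! k]" g F] r \<open>g \<in> V\<close> step k by (simp add: z_def)
      ultimately show ?case using Suc h(1)[of k] by auto
    qed simp
    from this[of "length r"] show ?thesis using h(2) by simp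
  qed simp
  have cong: "parity F v0 u = parity F v0 v"
    if "u \<in> words S" "v \<in> words S" "v0 \<otimes>\<^bsub>P\<^esub> cls u = v0 \<otimes>\<^bsub>P\<^esub> cls v" for u v
  proof -
    have "cls u = cls v" using that v0 by simp
    then have "(u, v) \<in> word_cong S R" using that by (simp add: word_class_eq_iff)
    then show ?thesis using parity_cong[OF _ rel] F v0 by blast
  qed
  have rep: "\<exists>w\<in>words S. x = v0 \<otimes>\<^bsub>P\<^esub> cls w" if x: "x \<in> V" for x
  proof -
    obtain w where "w \<in> words S" "inv\<^bsub>P\<^esub> v0 \<otimes>\<^bsub>P\<^esub> x = cls w"
      using V_rep[of "inv\<^bsub>P\<^esub> v0 \<otimes>\<^bsub>P\<^esub> x"] x v0 by auto
    moreover have "x = v0 \<otimes>\<^bsub>P\<^esub> (inv\<^bsub>P\<^esub> v0 \<otimes>\<^bsub>P\<^esub> x)" using x v0 by (simp flip: m_assoc)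
    ultimately show ?thesis by metis
  qed
  define X where "X = {v0 \<otimes>\<^bsub>P\<^esub> cls w | w. w \<in> words S \<and> \<not> parity F v0 w}"
  have X_iff: "v0 \<otimes>\<^bsub>P\<^esub> cls w \<in> X \<longleftrightarrow> \<not> parity F v0 w" if "w \<in> words S" for w
    unfolding X_def using cong[OF that] that by blast
  show ?thesis
  proof (intro exI[of _ X] conjI)
    show "X \<subseteq> V" using v0 by (auto simp: X_def)
    show "v0 \<in> X" using X_iff[of "[]"] v0 by (simp add: act_Nil)
    show "\<forall>(x, y)\<in>E. F x y \<longleftrightarrow> (x \<in> X) \<noteq> (y \<in> X)"
    proof clarify
      fix x y assume xy: "(x, y) \<in> E"
      obtain l where l: "x \<in> V" "fst l \<in> S" "y = x \<otimes>\<^bsub>P\<^esub> cls [l]" using xy by (rule E_E)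
      obtain w where w: "w \<in> words S" "x = v0 \<otimes>\<^bsub>P\<^esub> cls w" using rep[OF l(1)] by blast
      have y: "y = v0 \<otimes>\<^bsub>P\<^esub> cls (w @ [l])" using w l v0 by (simp add: act_append)
      have "parity F v0 (w @ [l]) = (parity F v0 w \<noteq> F x y)"
        using parity_append[of w "[l]" v0 F] w l v0 by simp
      moreover have "x \<in> X \<longleftrightarrow> \<not> parity F v0 w" unfolding w(2) by (rule X_iff[OF w(1)])
      moreover have "y \<in> X \<longleftrightarrow> \<not> parity F v0 (w @ [l])" unfolding y by (rule X_iff) (use w l in auto)
      ultimately show "F x y \<longleftrightarrow> (x \<in> X) \<noteq> (y \<in> X)" by blast
    qed
  qed
qed

section \<open>Translation to the graph-theoretic definitions\<close>

text \<open>Reachability in a digraph requires the start to be a vertex. The resulting empty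
  component is what turns "infinite cluster" into "\<open>v0\<close> occupied and infinite"
  later.\<close>

lemma component_induced:
  "component (G \<restriction> W) x = (if x \<in> W then (Restr E W)\<^sup>* `` {x} else {})"
proof -
  have ends: "arcs_ends (G \<restriction> W) = Restr E W" "verts (G \<restriction> W) = W"
    by (auto simp: arcs_ends_def arc_to_ends_def induce_subgraph_def presentation_graph_def
        cayley_graph_def image_iff)
  have "(x, y) \<in> rtrancl_on W (Restr E W) \<longleftrightarrow> x \<in> W \<and> (x, y) \<in> (Restr E W)\<^sup>*" for y
  proof
    assume "(x, y) \<in> rtrancl_on W (Restr E W)"
    then show "x \<in> W \<and> (x, y) \<in> (Restr E W)\<^sup>*"
      by (induction rule: rtrancl_on_induct) (auto intro: rtrancl_into_rtrancl)
  next
    assume "x \<in> W \<and> (x, y) \<in> (Restr E W)\<^sup>*"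
    then have "(x, y) \<in> (Restr E W)\<^sup>*" "x \<in> W" by auto
    then show "(x, y) \<in> rtrancl_on W (Restr E W)"
      by (induction rule: rtrancl_induct) (auto intro: rtrancl_on_into_rtrancl_on)
  qed
  then show ?thesis unfolding component_def reachable_def ends by auto
qed

lemma cycle_graph_presentation:
  assumes inf: "infinite (verts G)" and ends: "one_ended G" and v0: "v0 \<in> verts G"
    and d: "2 \<le> cayley_degree S R" and m: "1 \<le> longest_relator_cycle S R div 2"
  shows "cycle_graph V E relator_cycles (longest_relator_cycle S R div 2) (cayley_degree S R) v0"
proof
  show "infinite V" "v0 \<in> V" using inf v0 verts_G by auto
  show "finite (E `` {x}) \<and> card (E `` {x}) \<le> cayley_degree S R" if "x \<in> V" for x
    using degree_eq[OF that] by simp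
  show "z i \<in> V" if "(L, z) \<in> relator_cycles" for L z i
    using that by (rule relator_cyclesE) simp
  show "0 < L \<and> z (i + L) = z i" if "(L, z) \<in> relator_cycles" for L z i
    using that by (rule relator_cyclesE) simp
  show "(z i, z (Suc i)) \<in> E\<^sup>=" if "(L, z) \<in> relator_cycles" for L z i
    using that
  proof (rule relator_cyclesE)
    fix g r assume gr: "g \<in> V" "r \<in> R" "r \<noteq> []" "r \<in> words S" "L = length r"
      "\<And>i. z i = g \<otimes>\<^bsub>P\<^esub> cls (take (i mod length r) r)"
    show "(z i, z (Suc i)) \<in> E\<^sup>="
      unfolding gr(6) relator_cycle_step(1)[OF gr(1-3)]
      by (rule step_reflcl[OF _ relator_cycle_step(2)[OF gr(1-3)]]) (use gr in simp)
  qed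
  show "(z i, z j) \<in> (E\<^sup>=) ^^ (longest_relator_cycle S R div 2)" if "(L, z) \<in> relator_cycles" for L z i j
    using that
  proof (rule relator_cyclesE)
    fix g r assume gr: "g \<in> V" "r \<in> R" "r \<noteq> []" "r \<in> words S" "L = length r"
      "\<And>i. z i = g \<otimes>\<^bsub>P\<^esub> cls (take (i mod length r) r)"
    have lt: "k mod length r \<le> length r" for k using gr(3) by (simp add: less_imp_le)
    have "(z i, z j) \<in> (E\<^sup>=) ^^ (length r div 2)"
      unfolding gr(6)
      using relator_cycle_near[OF gr(1,2) _ lt, of "i mod length r" j]
        relator_cycle_near[OF gr(1,2) _ lt, of "j mod length r" i]
      by (cases "i mod length r \<le> j mod length r") auto
    moreover have "length r div 2 \<le> longest_relator_cycle S R div 2"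
      using length_relator_le[OF gr(2)] by (rule div_le_mono)
    ultimately show ?thesis using relpow_reflcl_mono by blast
  qed
  show "\<exists>X\<subseteq>V. v0 \<in> X \<and> (\<forall>(x, y)\<in>E. F x y \<longleftrightarrow> (x \<in> X) \<noteq> (y \<in> X))"
    if "\<And>x y. F x y \<Longrightarrow> F y x \<and> (x, y) \<in> E"
      "\<And>L z. (L, z) \<in> relator_cycles \<Longrightarrow>
        \<exists>h :: nat \<Rightarrow> bool. (\<forall>i. F (z i) (z (Suc i)) \<longleftrightarrow> h i \<noteq> h (Suc i)) \<and> h L = h 0" for F
    using v0 verts_G by (intro cut_exists that) auto
  show "\<exists>!U. U \<in> (\<lambda>x. (Restr E (V - C))\<^sup>* `` {x}) ` (V - C) \<and> infinite U"
    if "finite C" "C \<subseteq> V" for C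
  proof -
    have "component (G \<restriction> (V - C)) ` (V - C) = (\<lambda>x. (Restr E (V - C))\<^sup>* `` {x}) ` (V - C)"
      by (rule image_cong) (simp_all add: component_induced)
    moreover have "\<exists>!U. U \<in> component (G \<restriction> (V - C)) ` (V - C) \<and> infinite U"
      using ends[unfolded one_ended_def verts_G, rule_format, of C] that by simp
    ultimately show ?thesis by (simp only:)
  qed
  show "\<exists>g. g l = x \<and> (\<forall>i<2 * l. (g i, g (Suc i)) \<in> E) \<and>
      (\<forall>i j k. i \<le> j \<and> j \<le> 2 * l \<and> (g i, g j) \<in> (E\<^sup>=) ^^ k \<longrightarrow> j - i \<le> k)" if "x \<in> V" for x l
    by (rule geodesic_exists) (use inf that verts_G in auto)
qed (fact E_subset E_sym E_connected d m)+

lemma theta_eq: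
  "theta G v0 p = measure (Pi\<^sub>M V (\<lambda>_. measure_pmf (bernoulli_pmf p)))
     {\<omega> \<in> space (Pi\<^sub>M V (\<lambda>_. measure_pmf (bernoulli_pmf p))).
       v0 \<in> {x \<in> V. \<omega> x} \<and> infinite ((Restr E {x \<in> V. \<omega> x})\<^sup>* `` {v0})}"
proof -
  have if_inf: "infinite (if b then A else {}) \<longleftrightarrow> b \<and> infinite A" for b and A :: "'a word set set"
    by simp
  have "infinite (cluster G v0 \<omega>) \<longleftrightarrow>
      v0 \<in> {x \<in> V. \<omega> x} \<and> infinite ((Restr E {x \<in> V. \<omega> x})\<^sup>* `` {v0})" for \<omega>
    unfolding cluster_def component_induced verts_G by (rule if_inf)
  then show ?thesis unfolding theta_def site_percolation_def verts_G by (simp only:)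
qed

end

section \<open>The bound for Cayley graphs\<close>

lemma p_analytic_le:
  assumes "0 \<le> p" "p \<le> 1" "real_analytic_on (theta G v) {p<..1}"
  shows "p_analytic G v \<le> p"
  unfolding p_analytic_def using assms by (intro cInf_lower) (auto intro!: bdd_belowI[of _ 0])

theorem corollary10p14:
  fixes S :: "'a set" and R :: "'a word set" and v0 :: "'a word set"
  assumes "finite S" and "finite R" and "R \<subseteq> words S"
    and "relators_induce_cycles S R"
    and "infinite (verts (presentation_graph S R))"
    and "one_ended (presentation_graph S R)"
    and "v0 \<in> verts (presentation_graph S R)"
  shows "p_analytic (presentation_graph S R) v0 \<le> 1 - 1 / gamma_dot S R"
proof -
  interpret finite_presentation S R
    using assms(1-3) by unfold_locales
  let ?d = "cayley_degree S R" and ?m = "longest_relator_cycle S R div 2"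
  show ?thesis
  proof (cases "2 \<le> ?d \<and> 1 \<le> ?m")
    case True
    interpret cycle_graph V E relator_cycles ?m ?d v0
      by (rule cycle_graph_presentation) (use assms True in auto)
    have gamma: "gamma_dot S R = (real (?d ^ ?m) - 1) * exp 1"
      by (simp add: gamma_dot_def)
    have "1 \<le> gamma_dot S R" "real_analytic_on (theta G v0) {1 - 1 / gamma_dot S R<..1}"
      unfolding gamma by (rule real_analytic_on_percolation[OF theta_eq])+
    then show ?thesis by (intro p_analytic_le) auto
  next
    case False
    \<comment> \<open>In the degenerate case \<open>gamma_dot\<close> is at most 0, so, with 1 / 0 =
      0, the claimed bound is at least 1. Analyticity on the empty interval above 1 then
      suffices.\<close>
    then have "real ?d ^ ?m \<le> 1"
      by (cases "?m = 0") (auto intro!: power_le_one)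
    then have "gamma_dot S R \<le> 0"
      unfolding gamma_dot_def by (intro mult_nonpos_nonneg) auto
    then have "1 / gamma_dot S R \<le> 0" by (simp add: divide_nonneg_nonpos)
    moreover have "p_analytic (presentation_graph S R) v0 \<le> 1"
      by (rule p_analytic_le) (auto simp: real_analytic_on_def)
    ultimately show ?thesis by linarith
  qed
qed

end
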